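(* Let $n\ge2$, $p>n$ and $1\le q<p$. There exist constants $\Theta=\Theta(n,p,q)\ge0$ and $C=C(n,p,q)>0$ such that for every bounded domain $\Omega\subset\mathbb{R}^n$ containing the origin, all $u\in C_c^\infty(\Omega\setminus\{0\})$, any open ball $B_r\subset\mathbb{R}^n$ of radius $r\in(0,\operatorname{diam}(\Omega))$, and any $D\ge e^\Theta\operatorname{diam}(\Omega)$ $$r^{n/p}X^{1/p}(r/D)\left(\frac1{|B_r|}\int_{B_r}\frac{|u|^q}{|x|^q}dx\right)^{1/q}\le C\left(\int_\Omega|\nabla u|^pdx-\Big(\frac{p-n}{p}\Big)^p\int_\Omega\frac{|u|^p}{|x|^p}dx\right)^{1/p}.$$
   Context: A domain is an open connected subset of $\mathbb{R}^n$. $X(t):=(1-\log t)^{-1}$ for $t\in(0,1]$, and $X^{1/p}(t)=(X(t))^{1/p}$. $|B_r|$ is the Lebesgue measure of $B_r$. Functions in $C_c^\infty(\Omega\setminus\{0\})$ are extended by zero to $\mathbb{R}^n$. *)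

theory Defs
  imports "HOL-Analysis.Analysis"
begin

(* k times continuously differentiable on S; meant for open S. *)
primrec Ck_on :: "nat \<Rightarrow> 'a::euclidean_space set \<Rightarrow> ('a \<Rightarrow> real) \<Rightarrow> bool" where
  "Ck_on 0 S f \<longleftrightarrow> continuous_on S f"
| "Ck_on (Suc k) S f \<longleftrightarrow>
     (\<forall>x\<in>S. f differentiable (at x)) \<and>
     (\<forall>b\<in>Basis. Ck_on k S (\<lambda>x. frechet_derivative f (at x) b))"

definition smooth_on :: "'a::euclidean_space set \<Rightarrow> ('a \<Rightarrow> real) \<Rightarrow> bool" where
  "smooth_on S f \<longleftrightarrow> (\<forall>k. Ck_on k S f)"

(* Functions are total, so an element of C_c^infinity(U) is represented by its
   extension by zero to the whole space: the support is taken in the whole space. *)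
definition test_functions :: "'a::euclidean_space set \<Rightarrow> ('a \<Rightarrow> real) set" where
  "test_functions U =
     {u. smooth_on U u \<and> compact (closure {x. u x \<noteq> 0}) \<and> closure {x. u x \<noteq> 0} \<subseteq> U}"

definition gradient :: "('a::euclidean_space \<Rightarrow> real) \<Rightarrow> 'a \<Rightarrow> 'a" where
  "gradient u x = (\<Sum>b\<in>Basis. frechet_derivative u (at x) b *\<^sub>R b)"

definition bounded_domain :: "'a::euclidean_space set \<Rightarrow> bool" where
  "bounded_domain S \<longleftrightarrow> open S \<and> connected S \<and> bounded S"

(* Only used for arguments in (0, 1]. *)
definition logX :: "real \<Rightarrow> real" where
  "logX t = inverse (1 - ln t)"

end

theory Submission
  imports Defs
begin

text \<open>
  Only the radial derivative of \<open>u\<close> is needed.  On a ray put \<open>f s = u (s y)\<close> and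
  \<open>\<alpha> = (p - n) / p\<close>.  For positive \<open>k\<close>, Young's inequality with \<open>k f / s\<close> bounds
  \<open>s\<^sup>n\<^sup>-\<^sup>1 \<bar>f'\<bar>\<^sup>p - \<alpha>\<^sup>p s\<^sup>n\<^sup>-\<^sup>1\<^sup>-\<^sup>p \<bar>f\<bar>\<^sup>p\<close> from below by the derivative of
  \<open>k\<^sup>p\<^sup>-\<^sup>1 s\<^sup>n\<^sup>-\<^sup>p \<bar>f\<bar>\<^sup>p\<close> as soon as \<open>k\<close> satisfies a Riccati inequality.  The choices
  \<open>k = \<alpha>\<close> before a given point and \<open>k = \<alpha> (1 - \<gamma> / (2 \<gamma> + ln (b / s)))\<close> after it
  give \<open>s\<^sup>n\<^sup>-\<^sup>p \<bar>f s\<bar>\<^sup>p \<le> C (1 + ln (b / s)) J\<close>, where \<open>J\<close> is the Hardy deficit of \<open>f\<close>.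

  Integrating over all rays bounds \<open>\<integral> \<bar>u\<bar>\<^sup>p \<bar>x\<bar>\<^sup>-\<^sup>p W\<close> by \<open>(1 + ln (D / r))\<close> times the deficit of \<open>u\<close>
  for every radial weight \<open>W\<close> that vanishes like a power at the origin and
  is supported in \<open>\<bar>x\<bar> < r\<close> together with one annulus \<open>m \<le> \<bar>x\<bar> \<le> 3 m\<close>, \<open>m \<ge> r\<close>.  Such a set
  contains any ball of radius \<open>r\<close>, and Young's inequality passes from exponent \<open>p\<close> to \<open>q < p\<close>:
  this is where the power weight is paid for.
\<close>

subsection \<open>The Hardy inequality on a ray\<close>

text \<open>Convexity of \<open>t powr p\<close>: the tangent at \<open>b\<close> stays below the
  graph at \<open>a\<close>. The proof is weighted AM-GM with weights \<open>1 / p\<close> and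
  \<open>(p - 1) / p\<close>.\<close>

lemma powr_tangent_le:
  fixes a b p :: real
  assumes "p > 1" "a \<ge> 0" "b \<ge> 0"
  shows "p * b powr (p - 1) * a \<le> a powr p + (p - 1) * b powr p"
proof (cases "a = 0 \<or> b = 0")
  case True
  then show ?thesis using assms by auto
next
  case False
  have "(a powr p) powr (1 / p) * (b powr p) powr ((p - 1) / p)
      \<le> (1 / p) * a powr p + ((p - 1) / p) * b powr p"
    using assms False by (intro Youngs_inequality_0) (auto simp: field_simps)
  moreover have "(a powr p) powr (1 / p) = a" "(b powr p) powr ((p - 1) / p) = b powr (p - 1)"
    using assms by (auto simp: powr_powr)
  ultimately have "p * (a * b powr (p - 1)) \<le> p * ((1 / p) * a powr p + ((p - 1) / p) * b powr p)"
    using assms by (intro mult_left_mono) auto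
  also have "\<dots> = a powr p + (p - 1) * b powr p"
    using assms by (simp add: field_simps)
  finally show ?thesis by (simp add: mult_ac)
qed

lemma has_real_derivative_abs_powr:
  fixes x p :: real
  assumes "p > 1"
  shows "((\<lambda>x. \<bar>x\<bar> powr p) has_real_derivative p * (sgn x * \<bar>x\<bar> powr (p - 1))) (at x)"
proof -
  consider "x > 0" | "x < 0" | "x = 0" by linarith
  then show ?thesis
  proof cases
    case 1
    have "((\<lambda>x. x powr p) has_real_derivative p * (sgn x * \<bar>x\<bar> powr (p - 1))) (at x)"
      using 1 by (auto intro!: derivative_eq_intros)
    moreover have "eventually (\<lambda>y. y powr p = \<bar>y\<bar> powr p) (nhds x)"
      using eventually_nhds_in_open[of "{0<..}" x] 1 by (auto elim!: eventually_mono)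
    ultimately show ?thesis by (subst DERIV_cong_ev[OF refl _ refl, symmetric])
  next
    case 2
    have "((\<lambda>x. (-x) powr p) has_real_derivative p * (sgn x * \<bar>x\<bar> powr (p - 1))) (at x)"
      using 2 by (auto intro!: derivative_eq_intros)
    moreover have "eventually (\<lambda>y. (-y) powr p = \<bar>y\<bar> powr p) (nhds x)"
      using eventually_nhds_in_open[of "{..<0}" x] 2 by (auto elim!: eventually_mono)
    ultimately show ?thesis by (subst DERIV_cong_ev[OF refl _ refl, symmetric])
  next
    case 3
    \<comment> \<open>At the origin the difference quotient is bounded by
      \<open>\<bar>h\<bar> powr (p - 1)\<close>, which vanishes in the limit because
      \<open>p > 1\<close>. Hence zeros of \<open>f\<close> need no special treatment later.\<close>
    have "((\<lambda>h. \<bar>h\<bar> powr (p - 1)) \<longlongrightarrow> 0) (at 0)"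
      using assms by (auto intro!: tendsto_eq_intros)
    moreover have "norm (\<bar>h\<bar> powr p / h) \<le> \<bar>h\<bar> powr (p - 1)" for h :: real
      by (cases "h = 0") (auto simp: powr_diff)
    then have "eventually (\<lambda>h::real. norm (\<bar>h\<bar> powr p / h) \<le> \<bar>h\<bar> powr (p - 1)) (at 0)"
      by (intro always_eventually allI)
    ultimately have "((\<lambda>h. \<bar>h\<bar> powr p / h) \<longlongrightarrow> 0) (at 0)"
      by (rule Lim_null_comparison[rotated])
    then show ?thesis using 3 by (simp add: DERIV_def)
  qed
qed

lemma has_real_derivative_abs_powr_chain:
  fixes f :: "real \<Rightarrow> real"
  assumes "(f has_real_derivative f') (at x)" "p > 1"
    "D = p * (sgn (f x) * \<bar>f x\<bar> powr (p - 1)) * f'"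
  shows "((\<lambda>x. \<bar>f x\<bar> powr p) has_real_derivative D) (at x)"
  using DERIV_chain2[OF has_real_derivative_abs_powr assms(1)] assms(2,3) by simp

lemma continuous_on_abs_powr:
  fixes f :: "'a::topological_space \<Rightarrow> real"
  assumes "continuous_on A f" "p > 0"
  shows "continuous_on A (\<lambda>x. \<bar>f x\<bar> powr p)"
  by (rule continuous_on_powr'[OF continuous_on_rabs[OF assms(1)] continuous_on_const]) (use assms in auto)

text \<open>For \<open>k = \<alpha> * x\<close> the Riccati terms without \<open>k'\<close> are
  \<open>\<alpha> powr p\<close> times the first two terms here. On (0, 1] these increase to the
  value 1 at \<open>x = 1\<close>, so lowering \<open>k\<close> below \<alpha> loses only a
  second-order amount, which the \<open>k'\<close> term will have to cover.\<close>

lemma riccati_quadratic: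
  fixes p x :: real
  assumes "p \<ge> 2" "0 < x" "x \<le> 1"
  shows "1 \<le> p * x powr (p - 1) - (p - 1) * x powr p + p * (p - 1) / 2 * (1 - x)\<^sup>2"
proof -
  define F where "F = (\<lambda>x. p * x powr (p - 1) - (p - 1) * x powr p + p * (p - 1) / 2 * (1 - x)\<^sup>2)"
  have "F x \<ge> F 1"
  proof (rule DERIV_nonpos_imp_nonincreasing[OF \<open>x \<le> 1\<close>])
    fix t assume t: "x \<le> t" "t \<le> 1"
    have t0: "t > 0" using t assms by simp
    \<comment> \<open>The derivative factors, and \<open>p \<ge> 2\<close> decides the sign of the
      last factor; so \<open>F\<close> decreases to \<open>F 1 = 1\<close>.\<close>
    have "(F has_real_derivative p * (p - 1) * (1 - t) * (t powr (p - 2) - 1)) (at t)"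
      unfolding F_def using t0
      apply (auto intro!: derivative_eq_intros)
      using powr_add[of t "p - 2" 1] by (simp add: field_simps)
    moreover have "t powr (p - 2) \<le> 1" using t0 t assms by (simp add: powr_le1)
    then have "p * (p - 1) * (1 - t) * (t powr (p - 2) - 1) \<le> 0"
      using assms t by (intro mult_nonneg_nonpos mult_nonneg_nonneg) auto
    ultimately show "\<exists>y. (F has_real_derivative y) (at t) \<and> y \<le> 0" by blast
  qed
  then show ?thesis by (simp add: F_def)
qed

text \<open>The left side is the increment of \<open>\<Psi>\<close>, so it suffices to compare
  \<open>\<Psi>'\<close> with the integrand pointwise. The tangent inequality with
  \<open>a = \<bar>f'\<bar>\<close> and \<open>b = k * \<bar>f\<bar> / s\<close> removes the mixed
  term; what is left is a multiple of \<open>s powr (N - 1 - p) * \<bar>f\<bar> powr p\<close>, and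
  \<open>ric\<close> bounds its coefficient.\<close>

lemma hardy_riccati_segment:
  fixes N p a b \<alpha> :: real and f f' k k' :: "real \<Rightarrow> real"
  assumes p: "p > 1" and \<alpha>: "\<alpha> = (p - N) / p" and ab: "0 < a" "a \<le> b"
    and f: "\<And>s. s \<in> {a..b} \<Longrightarrow> (f has_real_derivative f' s) (at s)"
    and f': "continuous_on {a..b} f'"
    and k: "\<And>s. s \<in> {a..b} \<Longrightarrow> (k has_real_derivative k' s) (at s)"
    and k0: "\<And>s. s \<in> {a..b} \<Longrightarrow> k s > 0"
    and ric: "\<And>s. s \<in> {a..b} \<Longrightarrow>
      \<alpha> powr p \<le> - (p - 1) * s * k s powr (p - 2) * k' s
                  + p * \<alpha> * k s powr (p - 1) - (p - 1) * k s powr p"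
  shows "k b powr (p - 1) * (b powr (N - p) * \<bar>f b\<bar> powr p) -
         k a powr (p - 1) * (a powr (N - p) * \<bar>f a\<bar> powr p)
    \<le> integral {a..b} (\<lambda>s. s powr (N - 1) * \<bar>f' s\<bar> powr p
        - \<alpha> powr p * s powr (N - 1 - p) * \<bar>f s\<bar> powr p)"
proof -
  define \<Psi> where "\<Psi> = (\<lambda>s. k s powr (p - 1) * (s powr (N - p) * \<bar>f s\<bar> powr p))"
  define \<Psi>' where "\<Psi>' = (\<lambda>s. (p - 1) * k s powr (p - 2) * k' s * (s powr (N - p) * \<bar>f s\<bar> powr p)
     + k s powr (p - 1) * ((N - p) * s powr (N - p - 1) * \<bar>f s\<bar> powr p
       + s powr (N - p) * (p * (sgn (f s) * \<bar>f s\<bar> powr (p - 1)) * f' s)))"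
  define K where "K = (\<lambda>s. s powr (N - 1) * \<bar>f' s\<bar> powr p
        - \<alpha> powr p * s powr (N - 1 - p) * \<bar>f s\<bar> powr p)"
  have cf: "continuous_on {a..b} f"
    by (rule DERIV_continuous_on, rule has_field_derivative_at_within[OF f])
  define F where "F = (\<lambda>s. \<bar>f s\<bar> powr p)"
  have D: "(\<Psi> has_real_derivative \<Psi>' s) (at s)" if s: "s \<in> {a..b}" for s
  proof -
    have "(F has_real_derivative p * (sgn (f s) * \<bar>f s\<bar> powr (p - 1)) * f' s) (at s)"
      unfolding F_def by (rule has_real_derivative_abs_powr_chain[OF f[OF s] p refl])
    then show ?thesis
      unfolding \<Psi>_def \<Psi>'_def F_def[symmetric] fun_cong[OF F_def, symmetric] using s ab k0[OF s] p
      by (auto intro!: derivative_eq_intros k[OF s] simp: algebra_simps)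
  qed
  have "(\<Psi>' has_integral (\<Psi> b - \<Psi> a)) {a..b}"
    by (rule fundamental_theorem_of_calculus[OF ab(2)])
      (simp only: has_real_derivative_iff_has_vector_derivative[symmetric]
        has_field_derivative_at_within[OF D])
  moreover have "continuous_on {a..b} K"
    unfolding K_def using ab p
    by (intro continuous_on_diff continuous_on_mult continuous_on_const continuous_on_abs_powr cf f'
      continuous_on_powr continuous_on_id) auto
  then have "(K has_integral integral {a..b} K) {a..b}"
    by (intro integrable_integral integrable_continuous_real)
  moreover have "\<Psi>' s \<le> K s" if s: "s \<in> {a..b}" for s
  proof -
    have s0: "s > 0" using s ab by auto
    note ks = k0[OF s]
    define h where "h = s powr (N - 1 - p) * \<bar>f s\<bar> powr p"
    have h0: "h \<ge> 0" by (simp add: h_def)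
    define X where "X = s powr (N - 1) * (p * (k s * \<bar>f s\<bar> / s) powr (p - 1) * \<bar>f' s\<bar>)"
    have "X \<le> s powr (N - 1) * (\<bar>f' s\<bar> powr p + (p - 1) * (k s * \<bar>f s\<bar> / s) powr p)"
      unfolding X_def using ks s0 p by (intro mult_left_mono powr_tangent_le) auto
    also have "\<dots> = s powr (N - 1) * \<bar>f' s\<bar> powr p + (p - 1) * k s powr p * h"
      using ks s0 by (simp add: h_def powr_mult powr_divide powr_diff[of s "N - 1" p] distrib_left)
    finally have 1: "X \<le> s powr (N - 1) * \<bar>f' s\<bar> powr p + (p - 1) * k s powr p * h" .
    have Xeq: "X = k s powr (p - 1) * (s powr (N - p) * (p * \<bar>f s\<bar> powr (p - 1) * \<bar>f' s\<bar>))"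
      unfolding X_def using ks s0 powr_diff[of s "N - 1" "p - 1"] by (simp add: powr_mult powr_divide)
    have "sgn (f s) * f' s \<le> \<bar>f' s\<bar>" by (auto simp: sgn_if)
    then have "p * \<bar>f s\<bar> powr (p - 1) * (sgn (f s) * f' s) \<le> p * \<bar>f s\<bar> powr (p - 1) * \<bar>f' s\<bar>"
      using p by (intro mult_left_mono) auto
    then have "p * (sgn (f s) * \<bar>f s\<bar> powr (p - 1)) * f' s \<le> p * \<bar>f s\<bar> powr (p - 1) * \<bar>f' s\<bar>"
      by (simp only: mult_ac)
    then have 2: "k s powr (p - 1) * (s powr (N - p) * (p * (sgn (f s) * \<bar>f s\<bar> powr (p - 1)) * f' s)) \<le> X"
      unfolding Xeq by (intro mult_left_mono) auto
    have e: "N - p - 1 = N - 1 - p" by simp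
    have 3: "s powr (N - p) * \<bar>f s\<bar> powr p = s * h" "s powr (N - p - 1) * \<bar>f s\<bar> powr p = h"
      using s0 powr_mult_base[of s "N - 1 - p"] by (simp_all add: h_def e flip: mult.assoc)
    have "\<Psi>' s = ((p - 1) * s * k s powr (p - 2) * k' s + k s powr (p - 1) * (N - p)) * h
       + k s powr (p - 1) * (s powr (N - p) * (p * (sgn (f s) * \<bar>f s\<bar> powr (p - 1)) * f' s))"
      by (simp only: \<Psi>'_def mult.assoc 3) (simp only: algebra_simps)
    also have "\<dots> \<le> ((p - 1) * s * k s powr (p - 2) * k' s + k s powr (p - 1) * (N - p)) * h
       + (s powr (N - 1) * \<bar>f' s\<bar> powr p + (p - 1) * k s powr p * h)"
      using 1 2 by linarith
    \<comment> \<open>Here \<open>N - p = - (p * \<alpha>)\<close>, which makes the coefficient of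
      \<open>h\<close> the right side of \<open>ric\<close>, with a minus sign.\<close>
    also have "\<dots> = s powr (N - 1) * \<bar>f' s\<bar> powr p - (- (p - 1) * s * k s powr (p - 2) * k' s
                  + p * \<alpha> * k s powr (p - 1) - (p - 1) * k s powr p) * h"
      using p by (simp add: \<alpha> field_simps)
    also have "\<dots> \<le> s powr (N - 1) * \<bar>f' s\<bar> powr p - \<alpha> powr p * h"
      using ric[OF s] h0 by (intro diff_left_mono mult_right_mono) auto
    finally show ?thesis by (simp add: K_def h_def mult.assoc)
  qed
  ultimately have "\<Psi> b - \<Psi> a \<le> integral {a..b} K" by (rule has_integral_le)
  then show ?thesis by (simp add: \<Psi>_def K_def)
qed


text \<open>\<open>C\<close> is fixed before \<open>a\<close>, \<open>b\<close> and
  \<open>f\<close>: one constant has to serve every ray of every domain. The left endpoint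
  \<open>a\<close> is absent from the bound, so the support may come arbitrarily close to the
  origin.\<close>

definition log_hardy_bound :: "real \<Rightarrow> real \<Rightarrow> real \<Rightarrow> bool" where
  "log_hardy_bound N p C \<longleftrightarrow> C > 0 \<and> (\<forall>a b s\<^sub>0 f f'. 0 < a \<longrightarrow> a \<le> s\<^sub>0 \<longrightarrow> s\<^sub>0 \<le> b \<longrightarrow>
    (\<forall>s\<in>{a..b}. (f has_real_derivative f' s) (at s)) \<longrightarrow> continuous_on {a..b} f' \<longrightarrow>
    f a = 0 \<longrightarrow> f b = 0 \<longrightarrow>
    s\<^sub>0 powr (N - p) * \<bar>f s\<^sub>0\<bar> powr p \<le> C * (1 + ln (b / s\<^sub>0)) *
      integral {a..b} (\<lambda>s. s powr (N - 1) * \<bar>f' s\<bar> powr p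
        - ((p - N) / p) powr p * s powr (N - 1 - p) * \<bar>f s\<bar> powr p))"

text \<open>Let \<open>k\<close> jump down at \<open>s\<^sub>0\<close>, from \<alpha> on the left to
  a smaller solution on the right. Since \<open>f\<close> vanishes at \<open>a\<close> and
  \<open>b\<close>, adding the two segment estimates leaves only the boundary term at
  \<open>s\<^sub>0\<close>, with factor
  \<open>\<alpha> powr (p - 1) - k s\<^sub>0 powr (p - 1)\<close>. This gap is at least a constant
  over \<open>1 + ln (b / s\<^sub>0)\<close>.\<close>

lemma log_hardy_bound_exists:
  fixes N p :: real
  assumes p: "p \<ge> 2" and N: "N < p"
  shows "\<exists>C. log_hardy_bound N p C"
proof -
  define \<alpha> where "\<alpha> = (p - N) / p"
  have \<alpha>: "\<alpha> > 0" using p N by (simp add: \<alpha>_def)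
  \<comment> \<open>Chosen so that, with \<open>x = 1 - \<gamma> / t\<close>, the quadratic loss
    \<open>p * (p - 1) / 2 * (1 - x)\<^sup>2\<close> equals the gain from \<open>k'\<close> (divided
    by \<open>\<alpha> powr p\<close>) once its factor \<open>x powr (p - 2)\<close> is replaced by
    the lower bound \<open>(1/2) powr (p - 2)\<close>.\<close>
  define \<gamma> where "\<gamma> = 2 * (1/2) powr (p - 2) / (\<alpha> * p)"
  have \<gamma>: "\<gamma> > 0" using p \<alpha> by (simp add: \<gamma>_def)
  \<comment> \<open>The maximum comes from
    \<open>2 * \<gamma> + l \<le> max (2 * \<gamma>) 1 * (1 + l)\<close> for
    \<open>l \<ge> 0\<close>, applied to \<open>t s\<^sub>0\<close>.\<close>
  define C where "C = max (2 * \<gamma>) 1 / (\<alpha> powr (p - 1) * \<gamma>)"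
  have C: "C > 0" using \<alpha> \<gamma> by (simp add: C_def)
  have "s\<^sub>0 powr (N - p) * \<bar>f s\<^sub>0\<bar> powr p \<le> C * (1 + ln (b / s\<^sub>0)) *
      integral {a..b} (\<lambda>s. s powr (N - 1) * \<bar>f' s\<bar> powr p
        - \<alpha> powr p * s powr (N - 1 - p) * \<bar>f s\<bar> powr p)"
    if a: "0 < a" "a \<le> s\<^sub>0" "s\<^sub>0 \<le> b"
      and f: "\<And>s. s \<in> {a..b} \<Longrightarrow> (f has_real_derivative f' s) (at s)"
      and f': "continuous_on {a..b} f'" and f0: "f a = 0" "f b = 0"
    for a b s\<^sub>0 and f f' :: "real \<Rightarrow> real"
  proof -
    define K where "K = (\<lambda>s. s powr (N - 1) * \<bar>f' s\<bar> powr p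
        - \<alpha> powr p * s powr (N - 1 - p) * \<bar>f s\<bar> powr p)"
    define h where "h = s\<^sub>0 powr (N - p) * \<bar>f s\<^sub>0\<bar> powr p"
    have h: "h \<ge> 0" by (simp add: h_def)
    \<comment> \<open>The shift by \<open>2 * \<gamma>\<close> keeps
      \<open>\<gamma> / t \<le> 1/2\<close> as far as \<open>s = b\<close>, so that \<open>k\<close>
      stays at least \<open>\<alpha> / 2\<close>.\<close>
    define t where "t = (\<lambda>s. 2 * \<gamma> + ln b - ln s)"
    define k where "k = (\<lambda>s. \<alpha> * (1 - \<gamma> / t s))"
    define k' where "k' = (\<lambda>s. - \<alpha> * \<gamma> / (s * (t s)\<^sup>2))"
    have pos: "s > 0" "t s \<ge> 2 * \<gamma>" "t s > 0" "\<gamma> / t s \<le> 1/2" "\<gamma> / t s > 0"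
      if "s \<in> {s\<^sub>0..b}" for s
    proof -
      show s: "s > 0" using that a by auto
      have "ln s \<le> ln b" using s that by simp
      then show t: "t s \<ge> 2 * \<gamma>" by (simp add: t_def)
      with \<gamma> show t0: "t s > 0" by linarith
      show "\<gamma> / t s \<le> 1/2" "\<gamma> / t s > 0" using t t0 \<gamma> by (auto simp: field_simps)
    qed
    have kpos: "k s > 0" if "s \<in> {s\<^sub>0..b}" for s
    proof -
      have "1 - \<gamma> / t s > 0" using pos(4)[OF that] by linarith
      then show ?thesis using \<alpha> by (simp add: k_def)
    qed
    have "k b powr (p - 1) * (b powr (N - p) * \<bar>f b\<bar> powr p) -
          k s\<^sub>0 powr (p - 1) * (s\<^sub>0 powr (N - p) * \<bar>f s\<^sub>0\<bar> powr p) \<le> integral {s\<^sub>0..b} K"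
      unfolding K_def
    proof (rule hardy_riccati_segment[where k = k and k' = k' and f = f and f' = f' and a = s\<^sub>0 and b = b and N = N and p = p and \<alpha> = \<alpha>])
      fix s assume s: "s \<in> {s\<^sub>0..b}"
      note ps = pos[OF s]
      show "(k has_real_derivative k' s) (at s)"
        unfolding k_def k'_def t_def using ps[unfolded t_def]
        by (auto intro!: derivative_eq_intros simp: power2_eq_square)
      define x where "x = 1 - \<gamma> / t s"
      have x: "x \<ge> 1/2" "x \<le> 1" using ps by (auto simp: x_def)
      have kx: "k s = \<alpha> * x" by (simp add: k_def x_def)
      have "p * (p - 1) / 2 * (1 - x)\<^sup>2 = (p - 1) * (1/2) powr (p - 2) * \<gamma> / (\<alpha> * (t s)\<^sup>2)"
        using p \<alpha> ps by (simp add: x_def \<gamma>_def field_simps power2_eq_square)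
      also have "\<dots> \<le> (p - 1) * x powr (p - 2) * \<gamma> / (\<alpha> * (t s)\<^sup>2)"
        using p \<alpha> \<gamma> x by (intro divide_right_mono mult_right_mono mult_left_mono powr_mono2) auto
      finally have "1 \<le> (p - 1) * x powr (p - 2) * \<gamma> / (\<alpha> * (t s)\<^sup>2)
          + p * x powr (p - 1) - (p - 1) * x powr p"
        using riccati_quadratic[of p x] p x by linarith
      then have "\<alpha> powr p * 1 \<le> \<alpha> powr p * ((p - 1) * x powr (p - 2) * \<gamma> / (\<alpha> * (t s)\<^sup>2)
          + p * x powr (p - 1) - (p - 1) * x powr p)"
        by (intro mult_left_mono) auto
      also have "\<dots> = - (p - 1) * s * k s powr (p - 2) * k' s
          + p * \<alpha> * k s powr (p - 1) - (p - 1) * k s powr p"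
      proof -
        have "\<alpha> powr p = \<alpha> powr (p - 2) * \<alpha>\<^sup>2" "\<alpha> powr p = \<alpha> * \<alpha> powr (p - 1)"
          using \<alpha> by (auto simp: powr_diff power2_eq_square)
        then have e: "\<alpha> powr p / \<alpha> = \<alpha> powr (p - 2) * \<alpha>" "\<alpha> * \<alpha> powr (p - 1) = \<alpha> powr p"
          using \<alpha> by (auto simp: power2_eq_square)
        have "- (p - 1) * s * k s powr (p - 2) * k' s
            = (p - 1) * x powr (p - 2) * \<gamma> / (t s)\<^sup>2 * (\<alpha> powr (p - 2) * \<alpha>)"
          using ps \<alpha> x by (simp add: kx k'_def powr_mult field_simps)
        moreover have "p * \<alpha> * k s powr (p - 1) = p * x powr (p - 1) * (\<alpha> * \<alpha> powr (p - 1))"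
          using \<alpha> x by (simp add: kx powr_mult)
        moreover have "k s powr p = \<alpha> powr p * x powr p"
          using \<alpha> x by (simp add: kx powr_mult)
        moreover have "\<alpha> powr p * ((p - 1) * x powr (p - 2) * \<gamma> / (\<alpha> * (t s)\<^sup>2)
            + p * x powr (p - 1) - (p - 1) * x powr p)
          = (p - 1) * x powr (p - 2) * \<gamma> / (t s)\<^sup>2 * (\<alpha> powr p / \<alpha>)
            + p * x powr (p - 1) * \<alpha> powr p - (p - 1) * (\<alpha> powr p * x powr p)"
          using \<alpha> ps by (simp add: field_simps)
        ultimately show ?thesis by (simp only: e)
      qed
      finally show "\<alpha> powr p \<le> - (p - 1) * s * k s powr (p - 2) * k' s
          + p * \<alpha> * k s powr (p - 1) - (p - 1) * k s powr p" by simp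
      show "k s > 0" by (rule kpos[OF s])
      show "(f has_real_derivative f' s) (at s)" using s a by (intro f) auto
    next
      show "continuous_on {s\<^sub>0..b} f'" using a by (intro continuous_on_subset[OF f']) auto
    qed (use a p \<alpha>_def in auto)
    then have right: "- (k s\<^sub>0 powr (p - 1)) * h \<le> integral {s\<^sub>0..b} K"
      using f0 by (simp add: h_def)
    have "\<alpha> powr (p - 1) * (s\<^sub>0 powr (N - p) * \<bar>f s\<^sub>0\<bar> powr p) -
          \<alpha> powr (p - 1) * (a powr (N - p) * \<bar>f a\<bar> powr p) \<le> integral {a..s\<^sub>0} K"
      unfolding K_def
    proof (rule hardy_riccati_segment[where k = "\<lambda>_. \<alpha>" and k' = "\<lambda>_. 0" and f = f and f' = f' and a = a and b = s\<^sub>0 and N = N and p = p and \<alpha> = \<alpha>])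
      \<comment> \<open>The constant \<alpha> satisfies the Riccati inequality with
        equality.\<close>
      show "\<alpha> powr p \<le> - (p - 1) * s * \<alpha> powr (p - 2) * 0 + p * \<alpha> * \<alpha> powr (p - 1) - (p - 1) * \<alpha> powr p" for s
        using \<alpha> powr_mult_base[of \<alpha> "p - 1"] by (simp add: mult.assoc left_diff_distrib)
      show "(f has_real_derivative f' s) (at s)" if "s \<in> {a..s\<^sub>0}" for s
        using that a by (intro f) auto
      show "continuous_on {a..s\<^sub>0} f'" using a by (intro continuous_on_subset[OF f']) auto
    qed (use a p \<alpha> in \<open>simp_all add: \<alpha>_def\<close>)
    then have left: "\<alpha> powr (p - 1) * h \<le> integral {a..s\<^sub>0} K"
      using f0 by (simp add: h_def)
    have cf: "continuous_on {a..b} f"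
      by (rule DERIV_continuous_on, rule has_field_derivative_at_within[OF f])
    have "continuous_on {a..b} K"
      unfolding K_def using a p
      by (intro continuous_on_diff continuous_on_mult continuous_on_const continuous_on_abs_powr cf f'
        continuous_on_powr continuous_on_id) auto
    then have "integral {a..s\<^sub>0} K + integral {s\<^sub>0..b} K = integral {a..b} K"
      using a by (intro Henstock_Kurzweil_Integration.integral_combine integrable_continuous_real) auto
    with left right have J: "(\<alpha> powr (p - 1) - k s\<^sub>0 powr (p - 1)) * h \<le> integral {a..b} K"
      by (simp add: left_diff_distrib)
    have s0: "s\<^sub>0 \<in> {s\<^sub>0..b}" using a by auto
    note ps = pos[OF s0]
    \<comment> \<open>As \<open>p - 1 \<ge> 1\<close> and the base lies in [0, 1], the power is at
      most the base, so the gap is at least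
      \<open>\<alpha> powr (p - 1) * (\<gamma> / t s\<^sub>0)\<close>.\<close>
    have "(1 - \<gamma> / t s\<^sub>0) powr (p - 1) \<le> (1 - \<gamma> / t s\<^sub>0) powr 1"
      using ps p by (intro powr_mono') auto
    then have A: "\<alpha> powr (p - 1) * (1 - \<gamma> / t s\<^sub>0) powr (p - 1) \<le> \<alpha> powr (p - 1) * (1 - \<gamma> / t s\<^sub>0)"
      using ps by (intro mult_left_mono) auto
    then have "\<alpha> powr (p - 1) * (\<gamma> / t s\<^sub>0) \<le> \<alpha> powr (p - 1) - k s\<^sub>0 powr (p - 1)"
    proof -
      have "k s\<^sub>0 powr (p - 1) = \<alpha> powr (p - 1) * (1 - \<gamma> / t s\<^sub>0) powr (p - 1)"
        unfolding k_def by (rule powr_mult)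
      with A show ?thesis by (simp add: right_diff_distrib)
    qed
    then have B: "\<alpha> powr (p - 1) * (\<gamma> / t s\<^sub>0) * h \<le> integral {a..b} K"
      using J mult_right_mono[OF _ h] by (meson order_trans)
    then have 1: "h \<le> t s\<^sub>0 / (\<alpha> powr (p - 1) * \<gamma>) * integral {a..b} K"
      using ps \<alpha> \<gamma> by (simp add: field_simps)
    \<comment> \<open>The sign of the deficit is read off from the estimate itself; it permits
      enlarging the factor \<open>t s\<^sub>0\<close> in front of it.\<close>
    have K0: "integral {a..b} K \<ge> 0"
      using B ps h \<alpha>
      by (meson order_trans mult_nonneg_nonneg powr_ge_zero less_imp_le)
    have l: "ln (b / s\<^sub>0) = ln b - ln s\<^sub>0" "ln s\<^sub>0 \<le> ln b" using ps a by (auto simp: ln_div)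
    have "t s\<^sub>0 = 2 * \<gamma> + ln (b / s\<^sub>0)" by (simp add: t_def l)
    also have "\<dots> \<le> max (2 * \<gamma>) 1 + max (2 * \<gamma>) 1 * ln (b / s\<^sub>0)"
      using l mult_right_mono[of 1 "max (2 * \<gamma>) 1" "ln (b / s\<^sub>0)"] by (intro add_mono) auto
    finally have "t s\<^sub>0 \<le> max (2 * \<gamma>) 1 * (1 + ln (b / s\<^sub>0))" by (simp add: distrib_left)
    then have "t s\<^sub>0 / (\<alpha> powr (p - 1) * \<gamma>) \<le> C * (1 + ln (b / s\<^sub>0))"
      unfolding C_def using \<alpha> \<gamma> divide_right_mono[of "t s\<^sub>0" _ "\<alpha> powr (p - 1) * \<gamma>"] by fastforce
    from 1 mult_right_mono[OF this K0] show ?thesis by (simp add: h_def K_def)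
  qed
  then show ?thesis using C unfolding log_hardy_bound_def \<alpha>_def by blast
qed

subsection \<open>Integration over rays\<close>

lemma nn_integral_lborel_scaleR:
  fixes f :: "'a::euclidean_space \<Rightarrow> ennreal"
  assumes [measurable]: "f \<in> borel_measurable borel" and "c > 0"
  shows "(\<integral>\<^sup>+x. f x \<partial>lborel) = ennreal (c powr real DIM('a)) * (\<integral>\<^sup>+x. f (c *\<^sub>R x) \<partial>lborel)"
  by (subst lborel_affine[of c "0 :: 'a"])
     (use assms(2) in \<open>simp_all add: nn_integral_density nn_integral_distr nn_integral_cmult powr_realpow\<close>)

lemma nn_integral_inverse_Icc:
  fixes a b :: real
  assumes "0 < a" "a \<le> b"
  shows "(\<integral>\<^sup>+s. ennreal (1 / s) * indicator {a..b} s \<partial>lborel) = ennreal (ln (b / a))"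
proof -
  have "((\<lambda>s. 1 / s) has_integral (ln b - ln a)) {a..b}"
    using assms by (intro fundamental_theorem_of_calculus)
      (auto simp: has_real_derivative_iff_has_vector_derivative[symmetric] intro!: derivative_eq_intros)
  then have "(\<integral>\<^sup>+s. ennreal (indicator {a..b} s * (1 / s)) \<partial>lborel) = ennreal (ln b - ln a)"
    using assms by (intro nn_integral_has_integral_lebesgue) auto
  also have "ln b - ln a = ln (b / a)" using assms by (simp add: ln_div)
  finally show ?thesis
    by (subst (asm) nn_integral_cong[where v = "\<lambda>s. ennreal (1 / s) * indicator {a..b} s"])
      (auto split: split_indicator)
qed

definition shell :: "'a::euclidean_space set" where
  "shell = {y. 1 \<le> norm y \<and> norm y \<le> 2}"

lemma shell_measurable [measurable]: "shell \<in> sets borel"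
  unfolding shell_def by measurable

text \<open>A substitute for polar coordinates: averaging over the shell plays the role of
  integrating over the unit sphere, up to the factor \<open>ln 2\<close>.\<close>

lemma nn_integral_rays:
  fixes h :: "'a::euclidean_space \<Rightarrow> ennreal"
  assumes [measurable]: "h \<in> borel_measurable borel"
  shows "(\<integral>\<^sup>+y. indicator shell y *
            (\<integral>\<^sup>+s. indicator {0<..} s * ennreal (s powr (real DIM('a) - 1)) * h (s *\<^sub>R y) \<partial>lborel) \<partial>lborel)
         = ennreal (ln 2) * (\<integral>\<^sup>+x. h x \<partial>lborel)"
proof -
  define N where "N = real DIM('a)"
  have "(\<integral>\<^sup>+y. indicator shell y *
            (\<integral>\<^sup>+s. indicator {0<..} s * ennreal (s powr (N - 1)) * h (s *\<^sub>R y) \<partial>lborel) \<partial>lborel)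
      = (\<integral>\<^sup>+y. (\<integral>\<^sup>+s. indicator shell y *
            (indicator {0<..} s * ennreal (s powr (N - 1)) * h (s *\<^sub>R y)) \<partial>lborel) \<partial>lborel)"
    by (intro nn_integral_cong nn_integral_cmult[symmetric]) measurable
  also have "\<dots> = (\<integral>\<^sup>+s. (\<integral>\<^sup>+y. indicator shell y *
            (indicator {0<..} s * ennreal (s powr (N - 1)) * h (s *\<^sub>R y)) \<partial>lborel) \<partial>lborel)"
    by (rule lborel_pair.Fubini') measurable
  \<comment> \<open>For fixed \<open>s\<close> substitute \<open>x = s *\<^sub>R y\<close>; the
    Jacobian turns \<open>s powr (N - 1)\<close> into the scale-invariant density
    \<open>1 / s\<close>.\<close>
  also have "\<dots> = (\<integral>\<^sup>+s. (\<integral>\<^sup>+x. ennreal (1 / s) * indicator {0<..} s *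
            indicator shell (inverse s *\<^sub>R x) * h x \<partial>lborel) \<partial>lborel)"
  proof (rule nn_integral_cong)
    fix s :: real
    show "(\<integral>\<^sup>+y. indicator shell y *
            (indicator {0<..} s * ennreal (s powr (N - 1)) * h (s *\<^sub>R y)) \<partial>lborel)
        = (\<integral>\<^sup>+x. ennreal (1 / s) * indicator {0<..} s *
            indicator shell (inverse s *\<^sub>R x) * h x \<partial>lborel)"
    proof (cases "s > 0")
      case True
      have "(\<integral>\<^sup>+x. ennreal (1 / s) * indicator {0<..} s * indicator shell (inverse s *\<^sub>R x) * h x \<partial>lborel)
          = ennreal (s powr N) *
            (\<integral>\<^sup>+x. ennreal (1 / s) * indicator {0<..} s * indicator shell (inverse s *\<^sub>R (s *\<^sub>R x)) * h (s *\<^sub>R x) \<partial>lborel)"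
        unfolding N_def by (rule nn_integral_lborel_scaleR[OF _ True]) measurable
      also have "\<dots> = (\<integral>\<^sup>+x. ennreal (s powr N) * (ennreal (1 / s) * indicator {0<..} s *
              indicator shell (inverse s *\<^sub>R (s *\<^sub>R x)) * h (s *\<^sub>R x)) \<partial>lborel)"
        by (rule nn_integral_cmult[symmetric]) measurable
      also have "\<dots> = (\<integral>\<^sup>+y. indicator shell y *
            (indicator {0<..} s * ennreal (s powr (N - 1)) * h (s *\<^sub>R y)) \<partial>lborel)"
      proof (rule nn_integral_cong)
        fix x :: 'a
        have "ennreal (s powr (N - 1)) = ennreal (s powr N) * ennreal (1 / s)"
          using True by (simp add: powr_diff flip: ennreal_mult)
        then show "ennreal (s powr N) * (ennreal (1 / s) * indicator {0<..} s *
              indicator shell (inverse s *\<^sub>R (s *\<^sub>R x)) * h (s *\<^sub>R x))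
            = indicator shell x * (indicator {0<..} s * ennreal (s powr (N - 1)) * h (s *\<^sub>R x))"
          using True by (simp add: mult_ac)
      qed
      finally show ?thesis by simp
    qed simp
  qed
  also have "\<dots> = (\<integral>\<^sup>+x. (\<integral>\<^sup>+s. ennreal (1 / s) * indicator {0<..} s *
            indicator shell (inverse s *\<^sub>R x) * h x \<partial>lborel) \<partial>lborel)"
    by (rule lborel_pair.Fubini') measurable
  \<comment> \<open>For fixed \<open>x \<noteq> 0\<close> the admissible \<open>s\<close> fill
    \<open>{norm x / 2..norm x}\<close>, which has mass \<open>ln 2\<close> for the density
    \<open>1 / s\<close>, whatever \<open>x\<close> is.\<close>
  also have "\<dots> = (\<integral>\<^sup>+x. ennreal (ln 2) * h x \<partial>lborel)"
  proof (rule nn_integral_cong_AE, use AE_lborel_singleton[of "0::'a"] in eventually_elim)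
    case (elim x)
    have "(\<integral>\<^sup>+s. ennreal (1 / s) * indicator {0<..} s * indicator shell (inverse s *\<^sub>R x) * h x \<partial>lborel)
        = (\<integral>\<^sup>+s. (ennreal (1 / s) * indicator {norm x / 2..norm x} s) * h x \<partial>lborel)"
    proof (rule nn_integral_cong)
      fix s :: real
      have "norm x > 0" using elim by simp
      then have "s > 0" if "norm x / 2 \<le> s" using that by linarith
      then have "indicator {0<..} s * indicator shell (inverse s *\<^sub>R x)
          = (indicator {norm x / 2..norm x} s :: ennreal)"
        by (cases "s > 0") (auto simp: indicator_def shell_def field_simps)
      then show "ennreal (1 / s) * indicator {0<..} s * indicator shell (inverse s *\<^sub>R x) * h x
          = (ennreal (1 / s) * indicator {norm x / 2..norm x} s) * h x"
        by (simp only: mult.assoc)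
    qed
    also have "\<dots> = (\<integral>\<^sup>+s. ennreal (1 / s) * indicator {norm x / 2..norm x} s \<partial>lborel) * h x"
      by (rule nn_integral_multc) measurable
    also have "\<dots> = ennreal (ln 2) * h x"
      using elim by (subst nn_integral_inverse_Icc) auto
    finally show ?case .
  qed
  also have "\<dots> = ennreal (ln 2) * (\<integral>\<^sup>+x. h x \<partial>lborel)"
    by (rule nn_integral_cmult) measurable
  finally show ?thesis by (simp only: N_def)
qed

section \<open>The Hardy deficit of functions supported in an annulus\<close>

lemma nn_integral_continuous_Icc:
  fixes \<phi> :: "real \<Rightarrow> real" and \<psi> :: "real \<Rightarrow> ennreal"
  assumes c: "continuous_on {a..b} \<phi>" and nn: "\<And>s. s \<in> {a..b} \<Longrightarrow> \<phi> s \<ge> 0"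
    and eq: "\<And>s. \<psi> s = indicator {a..b} s * ennreal (\<phi> s)"
  shows "(\<integral>\<^sup>+s. \<psi> s \<partial>lborel) = ennreal (integral {a..b} \<phi>)"
proof -
  have "(\<phi> has_integral integral {a..b} \<phi>) {a..b}"
    by (intro integrable_integral integrable_continuous_real c)
  then have "(\<integral>\<^sup>+s. ennreal (indicator {a..b} s * \<phi> s) \<partial>lborel) = ennreal (integral {a..b} \<phi>)"
    using nn by (intro nn_integral_has_integral_lebesgue) auto
  moreover have "(\<integral>\<^sup>+s. \<psi> s \<partial>lborel) = (\<integral>\<^sup>+s. ennreal (indicator {a..b} s * \<phi> s) \<partial>lborel)"
    by (intro nn_integral_cong) (auto simp: eq split: split_indicator)
  ultimately show ?thesis by simp
qed

text \<open>Vanishing near the origin and far out makes both integrands of the deficit integrable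
  and gives zero boundary values on every ray. The outer radius \<open>d\<close> enters the
  estimates through a logarithm; the inner radius \<open>e\<close> enters no constant.\<close>

locale annular_function =
  fixes u :: "'a::euclidean_space \<Rightarrow> real" and g :: "'a \<Rightarrow> 'a" and e d :: real
  assumes deriv: "\<And>x. (u has_derivative (\<lambda>h. g x \<bullet> h)) (at x)"
    and cont: "continuous_on UNIV g"
    and e: "0 < e" "e \<le> d"
    and supp: "\<And>x. norm x < e \<or> d < norm x \<Longrightarrow> u x = 0 \<and> g x = 0"
begin

lemma cont_u: "continuous_on UNIV u"
  using deriv by (intro has_derivative_continuous_on) auto

lemma measurable_u [measurable]: "u \<in> borel_measurable borel"
  by (rule borel_measurable_continuous_onI[OF cont_u])

lemma measurable_g [measurable]: "g \<in> borel_measurable borel"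
  by (rule borel_measurable_continuous_onI[OF cont])

definition hardy :: "real \<Rightarrow> 'a \<Rightarrow> real" where
  "hardy p x = \<bar>u x\<bar> powr p / norm x powr p"

lemma measurable_hardy [measurable]: "hardy p \<in> borel_measurable borel"
  unfolding hardy_def[abs_def] by measurable

lemma hardy_nonneg: "hardy p x \<ge> 0"
  by (simp add: hardy_def)

text \<open>\<open>J\<close> is the deficit on one ray. It is added to the Hardy term instead of
  appearing as a difference, because the identity lives in the extended nonnegative reals. The
  logarithmic factor is cut off at 0 since it turns negative for large \<open>s\<close>, where the
  left side vanishes.\<close>

lemma hardy_ray:
  assumes p: "p \<ge> 2" and N: "real DIM('a) < p" and y: "y \<in> shell"
    and C: "log_hardy_bound (real DIM('a)) p C"
  shows "\<exists>J\<ge>0.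
    (\<integral>\<^sup>+s. indicator {0<..} s * ennreal (s powr (real DIM('a) - 1)) *
        ennreal (((p - real DIM('a)) / p) powr p * hardy p (s *\<^sub>R y)) \<partial>lborel) + ennreal J
    = (\<integral>\<^sup>+s. indicator {0<..} s * ennreal (s powr (real DIM('a) - 1)) *
        ennreal (norm (g (s *\<^sub>R y)) powr p) \<partial>lborel) \<and>
    (\<forall>s>0. s powr (real DIM('a)) * hardy p (s *\<^sub>R y) \<le> C * max 0 (1 + ln (2 * d / s)) * J)"
proof -
  define N where "N = real DIM('a)"
  have C0: "C > 0" using C by (simp add: log_hardy_bound_def)
  define \<beta> where "\<beta> = ((p - N) / p) powr p"
  have ny: "1 \<le> norm y" "norm y \<le> 2" using y by (auto simp: shell_def)
  then have y0: "y \<noteq> 0" by auto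
  \<comment> \<open>For \<open>1 \<le> norm y \<le> 2\<close> the points with
    \<open>s \<le> e / 4\<close> or \<open>s \<ge> 2 * d\<close> lie strictly outside the annulus,
    endpoints included, so \<open>f\<close> vanishes at \<open>a\<close> and
    \<open>b\<close>.\<close>
  define a where "a = e / 4"
  define b where "b = 2 * d"
  have ab: "0 < a" "a \<le> b" using e by (auto simp: a_def b_def)
  have out: "u (s *\<^sub>R y) = 0 \<and> g (s *\<^sub>R y) = 0" if "s > 0" "s \<le> a \<or> b \<le> s" for s
  proof (rule supp)
    show "norm (s *\<^sub>R y) < e \<or> d < norm (s *\<^sub>R y)"
      using that(2)
    proof
      assume "s \<le> a"
      then have "s * norm y \<le> a * 2" using ny that by (intro mult_mono) auto
      then show ?thesis using that e by (simp add: a_def)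
    next
      assume "b \<le> s"
      then have "b * 1 \<le> s * norm y" using ny that e by (intro mult_mono) (auto simp: b_def)
      then show ?thesis using that e by (simp add: b_def)
    qed
  qed
  have cray: "continuous_on {a..b} (\<lambda>s. s *\<^sub>R y)" by (intro continuous_intros)
  have cf: "continuous_on {a..b} (\<lambda>s. u (s *\<^sub>R y))"
    by (rule continuous_on_compose2[OF cont_u cray]) auto
  have cg: "continuous_on {a..b} (\<lambda>s. g (s *\<^sub>R y))"
    by (rule continuous_on_compose2[OF cont cray]) auto
  define P where "P = (\<lambda>s. s powr (N - 1) * norm (g (s *\<^sub>R y)) powr p)"
  define Q where "Q = (\<lambda>s. s powr (N - 1) * (\<beta> * hardy p (s *\<^sub>R y)))"
  have cP: "continuous_on {a..b} P" unfolding P_def using ab p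
    by (intro continuous_on_mult continuous_on_powr continuous_on_id continuous_on_const
      continuous_on_powr' continuous_on_norm cg) auto
  have cQ: "continuous_on {a..b} Q" unfolding Q_def hardy_def using ab p ny
    by (intro continuous_on_mult continuous_on_powr continuous_on_id continuous_on_const
      continuous_on_divide continuous_on_abs_powr continuous_on_norm cf cray) auto
  define J where "J = integral {a..b} (\<lambda>s. P s - Q s)"
  have PQ: "integral {a..b} P = integral {a..b} Q + J"
    unfolding J_def using cP cQ
    by (subst Henstock_Kurzweil_Integration.integral_diff) (auto intro: integrable_continuous_real)
  have iP: "(\<integral>\<^sup>+s. indicator {0<..} s * ennreal (s powr (N - 1)) *
        ennreal (norm (g (s *\<^sub>R y)) powr p) \<partial>lborel) = ennreal (integral {a..b} P)"
    using ab out
    by (intro nn_integral_continuous_Icc[OF cP])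
      (auto simp: P_def ennreal_mult split: split_indicator)
  have \<beta>: "\<beta> \<ge> 0" by (simp add: \<beta>_def)
  have iQ: "(\<integral>\<^sup>+s. indicator {0<..} s * ennreal (s powr (N - 1)) *
        ennreal (\<beta> * hardy p (s *\<^sub>R y)) \<partial>lborel) = ennreal (integral {a..b} Q)"
    using ab out \<beta>
    by (intro nn_integral_continuous_Icc[OF cQ])
      (auto simp: Q_def hardy_def simp flip: ennreal_mult split: split_indicator)
  have main: "s powr N * hardy p (s *\<^sub>R y) \<le> C * (1 + ln (b / s)) * J" if s: "s \<in> {a..b}" for s
  proof -
    define f where "f = (\<lambda>s. u (s *\<^sub>R y))"
    define f' where "f' = (\<lambda>s. g (s *\<^sub>R y) \<bullet> y)"
    define K where "K = (\<lambda>s. s powr (N - 1) * \<bar>f' s\<bar> powr p - \<beta> * s powr (N - 1 - p) * \<bar>f s\<bar> powr p)"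
    have df: "(f has_real_derivative f' t) (at t)" for t
    proof -
      have "((\<lambda>s. u (s *\<^sub>R y)) has_derivative (\<lambda>h. g (t *\<^sub>R y) \<bullet> (h *\<^sub>R y))) (at t)"
        by (rule has_derivative_compose[OF _ deriv]) (auto intro!: derivative_eq_intros)
      then show ?thesis
        by (simp add: has_field_derivative_def f_def f'_def mult_commute_abs)
    qed
    have cf': "continuous_on {a..b} f'" unfolding f'_def by (intro continuous_intros cg)
    have "s powr (N - p) * \<bar>f s\<bar> powr p \<le> C * (1 + ln (b / s)) * integral {a..b} K"
      unfolding K_def \<beta>_def N_def
      by (rule C[unfolded log_hardy_bound_def, THEN conjunct2, rule_format])
        (use s ab out[of a] out[of b] df cf' in \<open>auto simp: f_def\<close>)
    \<comment> \<open>Cauchy-Schwarz replaces the derivative along \<open>y\<close> by the full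
      gradient. It costs \<open>norm y powr p\<close>, which is also the factor in the Hardy term,
      because \<open>hardy\<close> divides by the norm of \<open>s *\<^sub>R y\<close> and not by
      \<open>s\<close>; so it cancels.\<close>
    also have "integral {a..b} K \<le> integral {a..b} (\<lambda>s. norm y powr p * (P s - Q s))"
    proof (rule integral_le)
      show "K integrable_on {a..b}" unfolding K_def using ab p
        by (intro integrable_continuous_real continuous_on_diff continuous_on_mult continuous_on_const
          continuous_on_abs_powr cf' cf[folded f_def] continuous_on_powr continuous_on_id) auto
      show "(\<lambda>s. norm y powr p * (P s - Q s)) integrable_on {a..b}"
        by (intro integrable_continuous_real continuous_intros cP cQ)
      fix t assume t: "t \<in> {a..b}"
      then have t0: "t > 0" using ab by auto
      have "\<bar>f' t\<bar> powr p \<le> (norm (g (t *\<^sub>R y)) * norm y) powr p"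
        unfolding f'_def using p by (intro powr_mono2 Cauchy_Schwarz_ineq2) auto
      then have "t powr (N - 1) * \<bar>f' t\<bar> powr p
          \<le> t powr (N - 1) * (norm (g (t *\<^sub>R y)) * norm y) powr p"
        by (intro mult_left_mono) auto
      also have "\<dots> = norm y powr p * P t"
        by (simp add: P_def powr_mult)
      finally have "t powr (N - 1) * \<bar>f' t\<bar> powr p \<le> norm y powr p * P t" .
      moreover have "\<beta> * t powr (N - 1 - p) * \<bar>f t\<bar> powr p = norm y powr p * Q t"
        using y0 t0 by (simp add: Q_def hardy_def f_def powr_mult powr_diff)
      ultimately show "K t \<le> norm y powr p * (P t - Q t)"
        by (simp add: K_def right_diff_distrib)
    qed
    also have "integral {a..b} (\<lambda>s. norm y powr p * (P s - Q s)) = norm y powr p * J"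
      by (simp add: J_def)
    finally have "s powr (N - p) * \<bar>f s\<bar> powr p \<le> C * (1 + ln (b / s)) * (norm y powr p * J)"
      using s ab C0 by (simp add: mult_left_mono)
    then have "s powr (N - p) * \<bar>f s\<bar> powr p / norm y powr p \<le> C * (1 + ln (b / s)) * J"
      using y0 by (simp add: pos_divide_le_eq mult_ac)
    moreover have "s powr N * hardy p (s *\<^sub>R y) = s powr (N - p) * \<bar>f s\<bar> powr p / norm y powr p"
      using s ab y0 by (simp add: hardy_def f_def powr_mult powr_diff)
    ultimately show ?thesis by simp
  qed
  \<comment> \<open>At \<open>s = b\<close> the logarithm is 0, so the pointwise bound reads
    \<open>0 \<le> C * J\<close>.\<close>
  have J0: "J \<ge> 0"
  proof -
    have "0 \<le> b powr N * hardy p (b *\<^sub>R y)" by (simp add: hardy_nonneg)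
    also have "\<dots> \<le> C * J" using main[of b] ab by simp
    finally show ?thesis using C0 by (simp add: zero_le_mult_iff)
  qed
  have "s powr N * hardy p (s *\<^sub>R y) \<le> C * max 0 (1 + ln (2 * d / s)) * J" if "s > 0" for s
  proof (cases "s \<in> {a..b}")
    case True
    have "C * (1 + ln (b / s)) * J \<le> C * max 0 (1 + ln (2 * d / s)) * J"
      using C0 J0 by (intro mult_left_mono mult_right_mono) (auto simp: b_def)
    with main[OF True] show ?thesis by linarith
  next
    case False
    then have "hardy p (s *\<^sub>R y) = 0" using out[OF that] by (auto simp: hardy_def)
    then show ?thesis using C0 J0 by simp
  qed
  moreover have "integral {a..b} Q \<ge> 0"
    using cQ \<beta> by (intro integral_nonneg integrable_continuous_real) (auto simp: Q_def hardy_nonneg)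
  ultimately show ?thesis
    using J0 PQ unfolding N_def[symmetric] \<beta>_def[symmetric] iP iQ by (intro exI[of _ J]) auto
qed

lemma integrable_annulus:
  fixes \<phi> :: "'a \<Rightarrow> real"
  assumes c: "continuous_on {x. e \<le> norm x \<and> norm x \<le> d} \<phi>"
    and z: "\<And>x. norm x < e \<or> d < norm x \<Longrightarrow> \<phi> x = 0"
  shows "integrable lborel \<phi>"
proof -
  have "{x::'a. e \<le> norm x \<and> norm x \<le> d} = cball 0 d - ball 0 e"
    by (auto simp: not_less)
  then have "compact {x::'a. e \<le> norm x \<and> norm x \<le> d}"
    by (simp add: compact_diff)
  then have "integrable lborel (\<lambda>x. indicator {x. e \<le> norm x \<and> norm x \<le> d} x *\<^sub>R \<phi> x)"
    by (intro borel_integrable_compact c)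
  also have "(\<lambda>x. indicator {x. e \<le> norm x \<and> norm x \<le> d} x *\<^sub>R \<phi> x) = \<phi>"
  proof
    fix x
    show "indicator {x. e \<le> norm x \<and> norm x \<le> d} x *\<^sub>R \<phi> x = \<phi> x"
      using z[of x] by (cases "e \<le> norm x \<and> norm x \<le> d") auto
  qed
  finally show ?thesis .
qed

lemma integrable_gradient: "p > 0 \<Longrightarrow> integrable lborel (\<lambda>x. norm (g x) powr p)"
  by (intro integrable_annulus continuous_on_powr' continuous_on_norm continuous_on_const
      continuous_on_subset[OF cont]) (auto simp: supp)

lemma integrable_hardy: "p > 0 \<Longrightarrow> integrable lborel (hardy p)"
  unfolding hardy_def[abs_def] using e
  by (intro integrable_annulus continuous_on_divide continuous_on_abs_powr continuous_on_powr
      continuous_on_norm continuous_on_id continuous_on_const continuous_on_subset[OF cont_u])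
    (auto simp: supp)

text \<open>Integrating the pointwise bound of \<open>hardy_ray\<close> against \<open>W\<close>
  along a ray costs \<open>C * \<Lambda> * J\<close>, and averaging \<open>J\<close> over the shell
  gives the deficit \<open>I\<close>; the factor \<open>ln 2\<close> cancels. Each inequality keeps
  sums on both sides until all terms are known to be finite.\<close>

lemma hardy_weighted:
  fixes W :: "'a \<Rightarrow> ennreal"
  assumes p: "p \<ge> 2" and N: "real DIM('a) < p"
    and C: "log_hardy_bound (real DIM('a)) p C"
    and W [measurable]: "W \<in> borel_measurable borel" and \<Lambda>0: "\<Lambda> > 0"
    and \<Lambda>: "\<And>y. y \<in> shell \<Longrightarrow>
      (\<integral>\<^sup>+s. indicator {0<..} s * ennreal (max 0 (1 + ln (2 * d / s)) / s) * W (s *\<^sub>R y) \<partial>lborel) \<le> ennreal \<Lambda>"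
  defines "I \<equiv> (LINT x|lborel. norm (g x) powr p)
      - ((p - real DIM('a)) / p) powr p * (LINT x|lborel. hardy p x)"
  shows "I \<ge> 0" "(\<integral>\<^sup>+x. ennreal (hardy p x) * W x \<partial>lborel) \<le> ennreal (C * \<Lambda> * I)"
proof -
  define N where "N = real DIM('a)"
  have C0: "C > 0" using C by (simp add: log_hardy_bound_def)
  define \<beta> where "\<beta> = ((p - N) / p) powr p"
  have \<beta>: "\<beta> \<ge> 0" by (simp add: \<beta>_def)
  define P where "P = (\<integral>\<^sup>+x. ennreal (norm (g x) powr p) \<partial>(lborel :: 'a measure))"
  define Q where "Q = (\<integral>\<^sup>+x. ennreal (\<beta> * hardy p x) \<partial>(lborel :: 'a measure))"
  define Z where "Z = (\<integral>\<^sup>+x. ennreal (hardy p x) * W x \<partial>(lborel :: 'a measure))"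
  define ray where "ray = (\<lambda>(h :: 'a \<Rightarrow> ennreal) y.
    \<integral>\<^sup>+s. indicator {0<..} s * ennreal (s powr (N - 1)) * h (s *\<^sub>R y) \<partial>lborel)"
  have ray: "(\<integral>\<^sup>+y. indicator shell y * ray h y \<partial>lborel) = ennreal (ln 2) * (\<integral>\<^sup>+x. h x \<partial>lborel)"
    if "h \<in> borel_measurable borel" for h
    unfolding ray_def N_def using that by (rule nn_integral_rays)
  have [measurable]: "ray h \<in> borel_measurable borel" if [measurable]: "h \<in> borel_measurable borel" for h
    unfolding ray_def by measurable
  have le: "ennreal (C * \<Lambda>) * ray (\<lambda>x. ennreal (\<beta> * hardy p x)) y + ray (\<lambda>x. ennreal (hardy p x) * W x) y
      \<le> ennreal (C * \<Lambda>) * ray (\<lambda>x. ennreal (norm (g x) powr p)) y" if y: "y \<in> shell" for y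
  proof -
    obtain J where J: "J \<ge> 0"
      and PQ: "ray (\<lambda>x. ennreal (\<beta> * hardy p x)) y + ennreal J = ray (\<lambda>x. ennreal (norm (g x) powr p)) y"
      and pt: "\<And>s. s > 0 \<Longrightarrow> s powr N * hardy p (s *\<^sub>R y) \<le> C * max 0 (1 + ln (2 * d / s)) * J"
      using hardy_ray[OF p N y C] unfolding ray_def N_def \<beta>_def by blast
    have "ray (\<lambda>x. ennreal (hardy p x) * W x) y \<le> (\<integral>\<^sup>+s. ennreal (C * J) *
        (indicator {0<..} s * ennreal (max 0 (1 + ln (2 * d / s)) / s) * W (s *\<^sub>R y)) \<partial>lborel)"
      unfolding ray_def
    proof (rule nn_integral_mono)
      fix s :: real
      show "indicator {0<..} s * ennreal (s powr (N - 1)) * (ennreal (hardy p (s *\<^sub>R y)) * W (s *\<^sub>R y))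
        \<le> ennreal (C * J) * (indicator {0<..} s * ennreal (max 0 (1 + ln (2 * d / s)) / s) * W (s *\<^sub>R y))"
      proof (cases "s > 0")
        case True
        have "s powr (N - 1) * hardy p (s *\<^sub>R y) = s powr N * hardy p (s *\<^sub>R y) / s"
          using True by (simp add: powr_diff)
        also have "\<dots> \<le> C * J * (max 0 (1 + ln (2 * d / s)) / s)"
          using divide_right_mono[OF pt[OF True], of s] True by (simp add: mult_ac)
        finally have "ennreal (s powr (N - 1)) * ennreal (hardy p (s *\<^sub>R y))
            \<le> ennreal (C * J) * ennreal (max 0 (1 + ln (2 * d / s)) / s)"
          using True C0 J by (simp add: hardy_nonneg flip: ennreal_mult)
        from mult_right_mono[OF this, of "W (s *\<^sub>R y)"] True show ?thesis
          by (simp add: mult.assoc)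
      qed simp
    qed
    also have "\<dots> = ennreal (C * J) * (\<integral>\<^sup>+s. indicator {0<..} s *
        ennreal (max 0 (1 + ln (2 * d / s)) / s) * W (s *\<^sub>R y) \<partial>lborel)"
      by (rule nn_integral_cmult) measurable
    also have "\<dots> \<le> ennreal (C * J) * ennreal \<Lambda>"
      by (intro mult_left_mono \<Lambda> y) auto
    also have "\<dots> = ennreal (C * \<Lambda>) * ennreal J"
      using C0 J \<Lambda>0 by (simp add: mult_ac flip: ennreal_mult)
    finally show ?thesis
      unfolding PQ[symmetric] distrib_left by (rule add_left_mono)
  qed
  have "ennreal (ln 2) * (ennreal (C * \<Lambda>) * Q + Z)
      = ennreal (C * \<Lambda>) * (\<integral>\<^sup>+y. indicator shell y * ray (\<lambda>x. ennreal (\<beta> * hardy p x)) y \<partial>lborel)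
        + (\<integral>\<^sup>+y. indicator shell y * ray (\<lambda>x. ennreal (hardy p x) * W x) y \<partial>lborel)"
    by (subst (1 2) ray) (simp_all add: Q_def Z_def distrib_left mult_ac)
  also have "\<dots> = (\<integral>\<^sup>+y. ennreal (C * \<Lambda>) * (indicator shell y * ray (\<lambda>x. ennreal (\<beta> * hardy p x)) y)
        + indicator shell y * ray (\<lambda>x. ennreal (hardy p x) * W x) y \<partial>lborel)"
    by (simp add: nn_integral_add nn_integral_cmult)
  also have "\<dots> \<le> (\<integral>\<^sup>+y. ennreal (C * \<Lambda>) * (indicator shell y * ray (\<lambda>x. ennreal (norm (g x) powr p)) y) \<partial>lborel)"
    using le by (intro nn_integral_mono) (auto split: split_indicator)
  also have "\<dots> = ennreal (ln 2) * (ennreal (C * \<Lambda>) * P)"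
    by (subst nn_integral_cmult, measurable, subst ray) (simp_all add: P_def mult_ac)
  finally have main: "ennreal (C * \<Lambda>) * Q + Z \<le> ennreal (C * \<Lambda>) * P"
    by (subst (asm) ennreal_mult_le_mult_iff) auto
  have P: "P = ennreal (LINT x|lborel. norm (g x) powr p)"
    unfolding P_def using p by (intro nn_integral_eq_integral integrable_gradient) auto
  have "Q = ennreal (LINT x|lborel. \<beta> * hardy p x)"
    unfolding Q_def using p \<beta>
    by (intro nn_integral_eq_integral integrable_mult_right integrable_hardy) (auto simp: hardy_nonneg)
  then have Q: "Q = ennreal (\<beta> * (LINT x|lborel. hardy p x))" by simp
  have nn: "(LINT x|lborel. hardy p x) \<ge> 0" "(LINT x|lborel. norm (g x) powr p) \<ge> 0"
    by (auto intro!: integral_nonneg_AE simp: hardy_nonneg)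
  \<comment> \<open>\<open>Z\<close> is finite because \<open>main\<close> puts it below a multiple
    of the finite integral \<open>P\<close>; only now can terms be subtracted.\<close>
  obtain z where z: "z \<ge> 0" "Z = ennreal z"
  proof -
    have "Z \<le> ennreal (C * \<Lambda>) * Q + Z" by (simp add: add_increasing)
    also note main
    also have "ennreal (C * \<Lambda>) * P < top" by (simp add: P ennreal_mult_less_top)
    finally show ?thesis using that by (cases Z) auto
  qed
  have "C * \<Lambda> * (\<beta> * (LINT x|lborel. hardy p x)) + z \<le> C * \<Lambda> * (LINT x|lborel. norm (g x) powr p)"
    using main C0 \<Lambda>0 \<beta> nn z unfolding P Q
    by (simp flip: ennreal_mult ennreal_plus)
  then have "z \<le> C * \<Lambda> * I"
    by (simp add: I_def \<beta>_def N_def right_diff_distrib)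
  moreover from this z C0 \<Lambda>0 show "I \<ge> 0"
    by (meson mult_pos_pos order_trans zero_le_mult_iff not_le)
  ultimately show "(\<integral>\<^sup>+x. ennreal (hardy p x) * W x \<partial>lborel) \<le> ennreal (C * \<Lambda> * I)"
    using z by (simp add: Z_def[symmetric] ennreal_leI)
qed

end

subsection \<open>Radial weights\<close>

lemma nn_integral_powr_from_0:
  fixes a r :: real
  assumes "a > -1" "r > 0"
  shows "(\<integral>\<^sup>+s. indicator {0..r} s * ennreal (s powr a) \<partial>lborel) = ennreal (r powr (a + 1) / (a + 1))"
proof -
  have "((\<lambda>s. s powr a) has_integral (r powr (a + 1) / (a + 1))) {0..r}"
    using assms by (intro has_integral_powr_from_0) auto
  then have "(\<integral>\<^sup>+s. ennreal (indicator {0..r} s * s powr a) \<partial>lborel) = ennreal (r powr (a + 1) / (a + 1))"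
    by (intro nn_integral_has_integral_lebesgue) auto
  moreover have "(\<integral>\<^sup>+s. indicator {0..r} s * ennreal (s powr a) \<partial>lborel)
      = (\<integral>\<^sup>+s. ennreal (indicator {0..r} s * s powr a) \<partial>lborel)"
    by (intro nn_integral_cong) (auto split: split_indicator)
  ultimately show ?thesis by simp
qed

text \<open>The exponent is half the critical one: along a ray the density becomes
  \<open>s powr (N / 2 - 1)\<close>, integrable at 0, and scaling produces \<open>r powr N\<close>.
  This singular weight will be the dual partner of \<open>radial_weight\<close>.\<close>

lemma nn_integral_ball_sqrt_singularity:
  "\<exists>K>0. \<forall>r>0. (\<integral>\<^sup>+x. indicator (ball 0 r) x * ennreal ((r / norm x) powr (real DIM('a) / 2))
      \<partial>(lborel :: 'a::euclidean_space measure)) \<le> ennreal (K * r powr real DIM('a))"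
proof -
  define N where "N = real DIM('a)"
  have N: "N > 0" by (simp add: N_def)
  define S where "S = measure lborel (cball (0::'a) 2)"
  have S0: "S \<ge> 0" by (simp add: S_def)
  have "emeasure lborel (shell :: 'a set) \<le> emeasure lborel (cball (0::'a) 2)"
    by (intro emeasure_mono) (auto simp: shell_def)
  also have "\<dots> = ennreal S"
    unfolding S_def by (intro emeasure_eq_ennreal_measure) (use emeasure_bounded_finite[OF bounded_cball, of "0::'a" 2] in auto)
  finally have S: "emeasure lborel (shell :: 'a set) \<le> ennreal S" .
  \<comment> \<open>\<open>S + 1\<close> instead of \<open>S\<close> makes \<open>K\<close> visibly
    positive.\<close>
  define K where "K = (S + 1) * (2 / N) / ln 2"
  have K: "K > 0" using S0 N by (simp add: K_def)
  have "(\<integral>\<^sup>+x. indicator (ball 0 r) x * ennreal ((r / norm x) powr (N / 2)) \<partial>(lborel :: 'a measure))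
      \<le> ennreal (K * r powr N)" (is "?I \<le> _") if r: "r > 0" for r
  proof -
    have [measurable]: "ball (0::'a) r \<in> sets borel" by simp
    have "ennreal (ln 2) * ?I = (\<integral>\<^sup>+y. indicator shell y *
        (\<integral>\<^sup>+s. indicator {0<..} s * ennreal (s powr (N - 1)) *
          (indicator (ball 0 r) (s *\<^sub>R y) * ennreal ((r / norm (s *\<^sub>R y)) powr (N / 2))) \<partial>lborel) \<partial>(lborel :: 'a measure))"
      unfolding N_def by (intro nn_integral_rays[symmetric]) measurable
    also have "\<dots> \<le> (\<integral>\<^sup>+y. ennreal (2 / N * r powr N) * indicator shell y \<partial>(lborel :: 'a measure))"
    proof (rule nn_integral_mono)
      fix y :: 'a
      have "(\<integral>\<^sup>+s. indicator {0<..} s * ennreal (s powr (N - 1)) *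
          (indicator (ball 0 r) (s *\<^sub>R y) * ennreal ((r / norm (s *\<^sub>R y)) powr (N / 2))) \<partial>lborel)
        \<le> ennreal (2 / N * r powr N)" if y: "y \<in> shell"
      proof -
        have ny: "1 \<le> norm y" using y by (simp add: shell_def)
        have "(\<integral>\<^sup>+s. indicator {0<..} s * ennreal (s powr (N - 1)) *
            (indicator (ball 0 r) (s *\<^sub>R y) * ennreal ((r / norm (s *\<^sub>R y)) powr (N / 2))) \<partial>lborel)
          \<le> (\<integral>\<^sup>+s. ennreal (r powr (N / 2)) * (indicator {0..r} s * ennreal (s powr (N / 2 - 1))) \<partial>lborel)"
        proof (rule nn_integral_mono)
          fix s :: real
          show "indicator {0<..} s * ennreal (s powr (N - 1)) *
            (indicator (ball 0 r) (s *\<^sub>R y) * ennreal ((r / norm (s *\<^sub>R y)) powr (N / 2)))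
            \<le> ennreal (r powr (N / 2)) * (indicator {0..r} s * ennreal (s powr (N / 2 - 1)))"
          proof (cases "s > 0 \<and> s *\<^sub>R y \<in> ball 0 r")
            case True
            then have s: "s > 0" "s * norm y < r" by auto
            have sy: "s \<le> s * norm y" using s ny by simp
            have "r / (s * norm y) \<le> r / s" using s sy r by (intro frac_le) auto
            then have "s powr (N - 1) * (r / (s * norm y)) powr (N / 2) \<le> s powr (N - 1) * (r / s) powr (N / 2)"
              using s sy r N by (intro mult_left_mono powr_mono2) auto
            also have "\<dots> = r powr (N / 2) * (s powr (N - 1) / s powr (N / 2))"
              using s r by (simp add: powr_divide)
            also have "s powr (N - 1) / s powr (N / 2) = s powr (N / 2 - 1)"
              by (simp add: algebra_simps flip: powr_diff)
            finally have "s powr (N - 1) * (r / (s * norm y)) powr (N / 2)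
              \<le> r powr (N / 2) * s powr (N / 2 - 1)" .
            moreover have "s \<le> r" using s sy by linarith
            ultimately show ?thesis
              using True s r by (simp add: ennreal_leI flip: ennreal_mult)
          next
            case False
            then show ?thesis by (auto split: split_indicator)
          qed
        qed
        also have "\<dots> = ennreal (r powr (N / 2)) * ennreal (r powr (N / 2 - 1 + 1) / (N / 2 - 1 + 1))"
          using r N by (subst nn_integral_cmult, measurable, subst nn_integral_powr_from_0) auto
        also have "\<dots> = ennreal (2 / N * r powr N)"
          using N by (simp flip: ennreal_mult powr_add)
        finally show ?thesis .
      qed
      then show "indicator shell y * (\<integral>\<^sup>+s. indicator {0<..} s * ennreal (s powr (N - 1)) *
          (indicator (ball 0 r) (s *\<^sub>R y) * ennreal ((r / norm (s *\<^sub>R y)) powr (N / 2))) \<partial>lborel)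
        \<le> ennreal (2 / N * r powr N) * indicator shell y"
        by (auto split: split_indicator)
    qed
    also have "\<dots> = ennreal (2 / N * r powr N) * emeasure lborel (shell :: 'a set)"
      by (simp add: nn_integral_cmult_indicator)
    also have "\<dots> \<le> ennreal (2 / N * r powr N) * ennreal (S + 1)"
      using S S0 by (intro mult_left_mono) (auto intro: order_trans ennreal_leI)
    also have "\<dots> = ennreal (ln 2) * ennreal (K * r powr N)"
    proof -
      have "2 / N * r powr N * (S + 1) = ln 2 * (K * r powr N)" by (simp add: K_def)
      then have "ennreal (2 / N * r powr N * (S + 1)) = ennreal (ln 2 * (K * r powr N))" by simp
      then show ?thesis
        using N ennreal_mult'[of "2 / N * r powr N" "S + 1"] ennreal_mult'[of "ln 2" "K * r powr N"] by simp
    qed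
    finally show ?thesis by (subst (asm) ennreal_mult_le_mult_iff) auto
  qed
  then show ?thesis using K unfolding N_def by blast
qed

definition radial_weight :: "real \<Rightarrow> real \<Rightarrow> real \<Rightarrow> 'a::euclidean_space \<Rightarrow> real" where
  "radial_weight \<delta> r m x = (if norm x < r then (norm x / r) powr \<delta>
     else if m \<le> norm x \<and> norm x \<le> 3 * m then 1 else 0)"

lemma radial_weight_measurable [measurable]: "radial_weight \<delta> r m \<in> borel_measurable borel"
  unfolding radial_weight_def[abs_def] by measurable

lemma radial_weight_nonneg: "radial_weight \<delta> r m x \<ge> 0"
  by (simp add: radial_weight_def)

lemma ln_le_powr_div:
  fixes x a :: real
  assumes "x > 0" "a > 0"
  shows "ln x \<le> x powr a / a"
  using ln_le_minus_one[of "x powr a"] assms by (simp add: ln_powr field_simps)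

text \<open>Near the origin half of the power \<delta> pays for the logarithm, by
  \<open>ln x \<le> x powr (\<delta> / 2) / (\<delta> / 2)\<close> at \<open>x = r / s\<close>, and
  the other half makes \<open>1 / s\<close> integrable. On the annulus the logarithm is at most a
  multiple of \<open>1 + ln (D / r)\<close>, and the mass for \<open>1 / s\<close> is at most
  \<open>ln 6\<close>, independently of \<open>m\<close>.\<close>

lemma radial_weight_ray:
  assumes \<delta>: "\<delta> > 0"
  shows "\<exists>K>0. \<forall>r m d D. \<forall>y::'a::euclidean_space. 0 < r \<longrightarrow> r \<le> m \<longrightarrow> 0 < d \<longrightarrow> d \<le> D \<longrightarrow> r \<le> D \<longrightarrow>
    y \<in> shell \<longrightarrow>
    (\<integral>\<^sup>+s. indicator {0<..} s * ennreal (max 0 (1 + ln (2 * d / s)) / s) *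
       ennreal (radial_weight \<delta> r m (s *\<^sub>R y)) \<partial>lborel) \<le> ennreal (K * (1 + ln (D / r)))"
proof -
  \<comment> \<open>\<open>2 + 2 / \<delta>\<close> bounds the logarithmic factor relative to
    \<open>L * t\<close>, and \<open>2 powr \<delta>\<close> comes from
    \<open>norm y \<le> 2\<close>.\<close>
  define c\<^sub>1 where "c\<^sub>1 = (2 + 2 / \<delta>) * 2 powr \<delta>"
  have c1: "c\<^sub>1 > 0" using \<delta> by (auto simp: c\<^sub>1_def intro!: mult_pos_pos add_pos_pos)
  define K where "K = c\<^sub>1 * (2 / \<delta>) + 3 * ln 6"
  have K: "K > 0" using c1 \<delta> by (auto simp: K_def intro!: add_pos_pos mult_pos_pos)
  have ln2: "ln 2 \<le> (1::real)" using ln_le_minus_one[of "2::real"] by simp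
  have "(\<integral>\<^sup>+s. indicator {0<..} s * ennreal (max 0 (1 + ln (2 * d / s)) / s) *
       ennreal (radial_weight \<delta> r m (s *\<^sub>R y)) \<partial>lborel) \<le> ennreal (K * (1 + ln (D / r)))"
    if r: "0 < r" "r \<le> m" "r \<le> D" and d: "0 < d" "d \<le> D" and y: "y \<in> shell"
    for r m d D and y :: 'a
  proof -
    define L where "L = 1 + ln (D / r)"
    have L: "L \<ge> 1" using r by (simp add: L_def)
    have ny: "1 \<le> norm y" "norm y \<le> 2" using y by (auto simp: shell_def)
    \<comment> \<open>Splitting at \<open>r\<close> isolates the singular part
      \<open>ln (r / s)\<close>; the part with \<open>d\<close> is controlled by
      \<open>L\<close>.\<close>
    have lnd: "1 + ln (2 * d / s) = 1 + ln 2 + ln (d / r) + ln (r / s)"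
      "ln (d / r) \<le> L - 1" if "s > 0" for s
      using that r d by (auto simp: ln_mult ln_div L_def)
    have bound: "max 0 (1 + ln (2 * d / s)) / s * radial_weight \<delta> r m (s *\<^sub>R y)
        \<le> L * c\<^sub>1 * r powr (- \<delta> / 2) * (indicator {0..r} s * s powr (\<delta> / 2 - 1))
          + 3 * L * (1 / s * indicator {m / 2..3 * m} s)" (is "_ \<le> ?A + ?B") if s: "s > 0" for s
    proof -
      have A: "?A \<ge> 0" using L c1 by (simp add: indicator_def)
      have B: "?B \<ge> 0" using L s by (simp add: indicator_def)
      consider "s * norm y < r" | "r \<le> s * norm y" "m \<le> s * norm y" "s * norm y \<le> 3 * m"
        | "radial_weight \<delta> r m (s *\<^sub>R y) = 0"
        using s by (force simp: radial_weight_def)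
      then show ?thesis
      proof cases
        case 1
        have "s \<le> s * norm y" using s ny by simp
        then have sr: "s < r" using 1 by linarith
        define t where "t = (r / s) powr (\<delta> / 2)"
        have t: "t \<ge> 1" unfolding t_def using sr s \<delta> by (intro ge_one_powr_ge_zero) auto
        have "1 + ln (2 * d / s) \<le> 1 + 1 + (L - 1) + t / (\<delta> / 2)"
          unfolding lnd(1)[OF s] t_def using ln2 lnd(2)[OF s] s r \<delta>
          by (intro add_mono ln_le_powr_div) auto
        also have "\<dots> \<le> 2 * (L * t) + (L * t) * (2 / \<delta>)"
        proof (intro add_mono)
          have "L * 1 \<le> L * t" "1 * t \<le> L * t" using L t by (auto intro: mult_left_mono mult_right_mono)
          then show "1 + 1 + (L - 1) \<le> 2 * (L * t)" using L t by linarith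
          show "t / (\<delta> / 2) \<le> L * t * (2 / \<delta>)"
            using mult_right_mono[OF \<open>1 * t \<le> L * t\<close>, of "2 / \<delta>"] \<delta> by simp
        qed
        finally have "max 0 (1 + ln (2 * d / s)) \<le> L * (2 + 2 / \<delta>) * t"
          using L t \<delta> by (simp add: algebra_simps)
        moreover have "radial_weight \<delta> r m (s *\<^sub>R y) \<le> 2 powr \<delta> * (s / r) powr \<delta>"
        proof -
          have "radial_weight \<delta> r m (s *\<^sub>R y) = (s * norm y / r) powr \<delta>"
            using 1 s by (simp add: radial_weight_def)
          also have "\<dots> \<le> (2 * (s / r)) powr \<delta>"
            using s r ny \<delta> by (intro powr_mono2) (auto simp: field_simps)
          finally show ?thesis by (simp only: powr_mult)
        qed
        ultimately have "max 0 (1 + ln (2 * d / s)) / s * radial_weight \<delta> r m (s *\<^sub>R y)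
            \<le> L * (2 + 2 / \<delta>) * t / s * (2 powr \<delta> * (s / r) powr \<delta>)"
          using s L t \<delta> by (intro mult_mono divide_right_mono) (auto simp: radial_weight_nonneg)
        also have "\<dots> = L * c\<^sub>1 * (t * (s / r) powr \<delta> / s)"
          by (simp add: c\<^sub>1_def)
        also have "t * (s / r) powr \<delta> / s = r powr (- \<delta> / 2) * s powr (\<delta> / 2 - 1)"
        proof -
          have e: "x powr \<delta> = x powr (\<delta> / 2) * x powr (\<delta> / 2)" for x :: real
            by (simp flip: powr_add)
          have "s powr (\<delta> / 2 - 1) = s powr (\<delta> / 2) / s" "r powr (- \<delta> / 2) = 1 / r powr (\<delta> / 2)"
            using s by (auto simp: powr_diff powr_minus_divide)
          then show ?thesis using s r by (simp add: t_def powr_divide e)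
        qed
        also have "L * c\<^sub>1 * (r powr (- \<delta> / 2) * s powr (\<delta> / 2 - 1)) = ?A"
          using s sr by simp
        finally show ?thesis using B by linarith
      next
        case 2
        \<comment> \<open>Since \<open>1 \<le> norm y \<le> 2\<close>, the range for
          \<open>s\<close> widens to \<open>{m / 2..3 * m}\<close>; as \<open>m \<ge> r\<close>,
          this keeps \<open>r / s \<le> 2\<close>.\<close>
        have "s * norm y \<le> s * 2" "s * 1 \<le> s * norm y" using s ny by (auto intro: mult_left_mono)
        with 2 have sm: "m / 2 \<le> s" "s \<le> 3 * m" by auto
        have "r / s \<le> 2" using sm r s by (simp add: field_simps)
        then have "ln (r / s) \<le> ln 2" using s r by simp
        then have "max 0 (1 + ln (2 * d / s)) \<le> 3 * L"
          unfolding lnd(1)[OF s] using ln2 lnd(2)[OF s] L by auto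
        then have "max 0 (1 + ln (2 * d / s)) / s * radial_weight \<delta> r m (s *\<^sub>R y) \<le> 3 * L / s * 1"
          using s L 2 by (intro mult_mono divide_right_mono) (auto simp: radial_weight_def)
        also have "\<dots> = ?B" using sm by simp
        finally show ?thesis using A by linarith
      next
        case 3
        then show ?thesis using A B by simp
      qed
    qed
    have "(\<integral>\<^sup>+s. indicator {0<..} s * ennreal (max 0 (1 + ln (2 * d / s)) / s) *
       ennreal (radial_weight \<delta> r m (s *\<^sub>R y)) \<partial>lborel)
      \<le> (\<integral>\<^sup>+s. ennreal (L * c\<^sub>1 * r powr (- \<delta> / 2)) * (indicator {0..r} s * ennreal (s powr (\<delta> / 2 - 1)))
          + ennreal (3 * L) * (ennreal (1 / s) * indicator {m / 2..3 * m} s) \<partial>lborel)"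
    proof (rule nn_integral_mono)
      fix s :: real
      show "indicator {0<..} s * ennreal (max 0 (1 + ln (2 * d / s)) / s) *
          ennreal (radial_weight \<delta> r m (s *\<^sub>R y))
        \<le> ennreal (L * c\<^sub>1 * r powr (- \<delta> / 2)) * (indicator {0..r} s * ennreal (s powr (\<delta> / 2 - 1)))
          + ennreal (3 * L) * (ennreal (1 / s) * indicator {m / 2..3 * m} s)"
      proof (cases "s > 0")
        case True
        have "ennreal (max 0 (1 + ln (2 * d / s)) / s) * ennreal (radial_weight \<delta> r m (s *\<^sub>R y))
          = ennreal (max 0 (1 + ln (2 * d / s)) / s * radial_weight \<delta> r m (s *\<^sub>R y))"
          using True by (intro ennreal_mult[symmetric]) (auto simp: radial_weight_nonneg)
        also have "\<dots> \<le> ennreal (L * c\<^sub>1 * r powr (- \<delta> / 2) * (indicator {0..r} s * s powr (\<delta> / 2 - 1))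
          + 3 * L * (1 / s * indicator {m / 2..3 * m} s))"
          by (intro ennreal_leI bound True)
        also have "\<dots> = ennreal (L * c\<^sub>1 * r powr (- \<delta> / 2)) * (indicator {0..r} s * ennreal (s powr (\<delta> / 2 - 1)))
          + ennreal (3 * L) * (ennreal (1 / s) * indicator {m / 2..3 * m} s)"
          using L c1 True by (simp split: split_indicator flip: ennreal_mult)
        finally show ?thesis using True by simp
      qed simp
    qed
    also have "\<dots> = ennreal (L * c\<^sub>1 * r powr (- \<delta> / 2)) *
          (\<integral>\<^sup>+s. indicator {0..r} s * ennreal (s powr (\<delta> / 2 - 1)) \<partial>lborel)
        + ennreal (3 * L) * (\<integral>\<^sup>+s. ennreal (1 / s) * indicator {m / 2..3 * m} s \<partial>lborel)"
    proof -
      define f where "f = (\<lambda>s. indicator {0..r} s * ennreal (s powr (\<delta> / 2 - 1)))"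
      define h where "h = (\<lambda>s. ennreal (1 / s) * indicator {m / 2..3 * m} s)"
      have [measurable]: "f \<in> borel_measurable borel" "h \<in> borel_measurable borel"
        unfolding f_def h_def by measurable
      have "(\<integral>\<^sup>+s. a * f s + b * h s \<partial>lborel) = a * (\<integral>\<^sup>+s. f s \<partial>lborel) + b * (\<integral>\<^sup>+s. h s \<partial>lborel)" for a b
        by (simp add: nn_integral_add nn_integral_cmult)
      then show ?thesis by (simp only: f_def h_def)
    qed
    also have "(\<integral>\<^sup>+s. indicator {0..r} s * ennreal (s powr (\<delta> / 2 - 1)) \<partial>lborel)
        = ennreal (r powr (\<delta> / 2 - 1 + 1) / (\<delta> / 2 - 1 + 1))"
      using r \<delta> by (intro nn_integral_powr_from_0) auto
    also have "(\<integral>\<^sup>+s. ennreal (1 / s) * indicator {m / 2..3 * m} s \<partial>lborel) = ennreal (ln (3 * m / (m / 2)))"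
      using r by (intro nn_integral_inverse_Icc) auto
    also have "ennreal (L * c\<^sub>1 * r powr (- \<delta> / 2)) * ennreal (r powr (\<delta> / 2 - 1 + 1) / (\<delta> / 2 - 1 + 1))
          + ennreal (3 * L) * ennreal (ln (3 * m / (m / 2))) = ennreal (L * c\<^sub>1 * (2 / \<delta>) + 3 * L * ln 6)"
    proof -
      have "r powr (- \<delta> / 2) * r powr (\<delta> / 2) = 1" using r by (simp flip: powr_add)
      then have 1: "L * c\<^sub>1 * r powr (- \<delta> / 2) * (r powr (\<delta> / 2 - 1 + 1) / (\<delta> / 2 - 1 + 1)) = L * c\<^sub>1 * (2 / \<delta>)"
        by simp
      have 2: "3 * m / (m / 2) = 6" using r by simp
      have pos: "L * c\<^sub>1 * r powr (- \<delta> / 2) \<ge> 0" "3 * L \<ge> 0" using L c1 by auto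
      have "L * c\<^sub>1 * (2 / \<delta>) \<ge> 0" "3 * L * ln 6 \<ge> 0" using L c1 \<delta> by auto
      then show ?thesis
        unfolding ennreal_mult'[OF pos(1), symmetric] ennreal_mult'[OF pos(2), symmetric] 1 2
        by (rule ennreal_plus[symmetric])
    qed
    also have "\<dots> = ennreal (K * (1 + ln (D / r)))"
      by (simp only: K_def L_def[symmetric] distrib_right distrib_left mult_ac)
    finally show ?thesis .
  qed
  then show ?thesis using K by blast
qed

section \<open>From exponent \<open>p\<close> to averages with exponent \<open>q\<close> over
  balls\<close>

context annular_function begin

text \<open>With weights satisfying \<open>W powr (q / p) * V powr (1 - q / p) = 1\<close>, Young's
  inequality splits \<open>hardy q\<close> into \<open>hardy p * W / M\<close> and \<open>V\<close>,
  up to the factor \<open>M powr (q / p)\<close>. The first part is controlled by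
  \<open>hardy_weighted\<close>, the second by direct integration. \<open>M\<close> is any positive
  bound of the scaled deficit, not the deficit itself, because it appears in a denominator and the
  deficit is only known to be nonnegative.\<close>

lemma hardy_average:
  assumes pq: "1 \<le> q" "q < p" and p: "p \<ge> 2" and N: "real DIM('a) < p"
    and C: "log_hardy_bound (real DIM('a)) p C"
    and K: "\<forall>r m d D. \<forall>y::'a. 0 < r \<longrightarrow> r \<le> m \<longrightarrow> 0 < d \<longrightarrow> d \<le> D \<longrightarrow> r \<le> D \<longrightarrow> y \<in> shell \<longrightarrow>
      (\<integral>\<^sup>+s. indicator {0<..} s * ennreal (max 0 (1 + ln (2 * d / s)) / s) *
         ennreal (radial_weight (real DIM('a) * (p - q) / (2 * q)) r m (s *\<^sub>R y)) \<partial>lborel)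
      \<le> ennreal (K * (1 + ln (D / r)))"
    and K0: "K > 0"
    and K': "\<forall>r>0. (\<integral>\<^sup>+x. indicator (ball 0 r) x * ennreal ((r / norm x) powr (real DIM('a) / 2))
      \<partial>(lborel :: 'a measure)) \<le> ennreal (K' * r powr real DIM('a))"
    and K'0: "K' > 0"
    and r: "0 < r" "r \<le> D" and D: "d \<le> D"
  defines "I \<equiv> (LINT x|lborel. norm (g x) powr p)
      - ((p - real DIM('a)) / p) powr p * (LINT x|lborel. hardy p x)"
  assumes M: "M > 0" "(1 + ln (D / r)) * I * r powr (- real DIM('a)) \<le> M"
  shows "I \<ge> 0" "(LINT x:ball c r|lborel. hardy q x)
    \<le> (C * K + K' + unit_ball_vol (real DIM('a))) * r powr real DIM('a) * M powr (q / p)"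
proof -
  define N where "N = real DIM('a)"
  have C0: "C > 0" using C by (simp add: log_hardy_bound_def)
  \<comment> \<open>This value gives \<open>\<delta> * (q / p) = N / 2 * (1 - q / p)\<close>, so the
    power in \<open>W\<close> is matched by the exponent \<open>N / 2\<close> in \<open>V\<close>,
    which is still integrable at the origin.\<close>
  define \<delta> where "\<delta> = N * (p - q) / (2 * q)"
  have N0: "N > 0" by (simp add: N_def)
  have \<delta>: "\<delta> > 0" using pq N0 by (simp add: \<delta>_def)
  define L where "L = 1 + ln (D / r)"
  have L: "L \<ge> 1" using r by (simp add: L_def)
  \<comment> \<open>Outside \<open>ball 0 r\<close>, the points of \<open>ball c r\<close> have norm between \<open>m\<close> and \<open>3 * m\<close>.\<close>
  define m where "m = max r (norm c - r)"
  have m: "r \<le> m" by (simp add: m_def)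
  define W where "W = (radial_weight \<delta> r m :: 'a \<Rightarrow> real)"
  define V where "V = (\<lambda>x::'a. if norm x < r then (r / norm x) powr (N / 2) else 1)"
  have [measurable]: "ball c' r' \<in> sets (borel :: 'a measure)" for c' r' by simp
  have Wm [measurable]: "(\<lambda>x. ennreal (W x)) \<in> borel_measurable borel" unfolding W_def by measurable
  have Vm [measurable]: "V \<in> borel_measurable borel" unfolding V_def by measurable
  have \<Lambda>: "(\<integral>\<^sup>+s. indicator {0<..} s * ennreal (max 0 (1 + ln (2 * d / s)) / s) * ennreal (W (s *\<^sub>R y)) \<partial>lborel)
      \<le> ennreal (K * L)" if "y \<in> shell" for y
    unfolding W_def \<delta>_def N_def L_def by (rule K[rule_format]) (use that r m e D in auto)
  have KL: "K * L > 0" using K0 L by simp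
  note hw = hardy_weighted[OF p N C Wm KL \<Lambda>, folded I_def]
  show I0: "I \<ge> 0" by (rule hw(1))
  have Z: "(\<integral>\<^sup>+x. ennreal (hardy p x) * ennreal (W x) \<partial>lborel) \<le> ennreal (C * (K * L) * I)" by (rule hw(2))
  have pt: "hardy q x \<le> M powr (q / p) * (hardy p x * W x / M + V x)" if x: "x \<in> ball c r" for x
  proof (cases "u x = 0")
    case True
    then show ?thesis using M by (simp add: hardy_def V_def)
  next
    case False
    then have "\<not> (norm x < e \<or> d < norm x)" using supp[of x] by auto
    then have x0: "norm x > 0" using e by auto
    have z: "hardy p x > 0" using False x0 by (simp add: hardy_def)
    have nx: "norm x < norm c + r" "norm c - r < norm x"
      using x norm_triangle_ineq2[of x c] norm_triangle_ineq2[of c x]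
      by (auto simp: dist_norm norm_minus_commute)
    have W0: "W x > 0 \<and> V x > 0 \<and> W x powr (q / p) * V x powr (1 - q / p) = 1"
    proof (cases "norm x < r")
      case True
      have "q > 0" "p > 0" using pq by auto
      then have "\<delta> * (q / p) = N / 2 * (1 - q / p)" by (simp add: \<delta>_def field_simps)
      then have "W x powr (q / p) = (norm x / r) powr (N / 2 * (1 - q / p))"
        using True by (simp only: W_def radial_weight_def powr_powr if_True)
      moreover have "V x powr (1 - q / p) = (r / norm x) powr (N / 2 * (1 - q / p))"
        using True by (simp add: V_def powr_powr)
      ultimately have "W x powr (q / p) * V x powr (1 - q / p) = 1"
        using x0 r by (simp flip: powr_mult)
      then show ?thesis using True x0 r by (simp add: W_def V_def radial_weight_def)
    next
      case False
      \<comment> \<open>The factor 3 arises from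
        \<open>norm x < norm c + r \<le> m + 2 * r \<le> 3 * m\<close>.\<close>
      moreover have "m \<le> norm x" "norm x \<le> 3 * m" using False nx by (auto simp: m_def max_def)
      ultimately show ?thesis by (simp add: W_def V_def radial_weight_def)
    qed
    have "hardy q x = hardy p x powr (q / p)"
      using pq by (simp add: hardy_def powr_divide powr_powr)
    also have "\<dots> = M powr (q / p) * ((hardy p x * W x / M) powr (q / p) * V x powr (1 - q / p))"
      using W0 M by (simp add: powr_divide powr_mult)
    also have "\<dots> \<le> M powr (q / p) * (q / p * (hardy p x * W x / M) + (1 - q / p) * V x)"
      using W0 M z pq by (intro mult_left_mono Youngs_inequality_0) auto
    also have "\<dots> \<le> M powr (q / p) * (1 * (hardy p x * W x / M) + 1 * V x)"
      using W0 M z pq by (intro mult_left_mono add_mono mult_right_mono) auto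
    finally show ?thesis by simp
  qed
  have V1: "(\<integral>\<^sup>+x. indicator (ball c r) x * ennreal (V x) \<partial>lborel)
      \<le> ennreal ((K' + unit_ball_vol N) * r powr N)"
  proof -
    have "(\<integral>\<^sup>+x. indicator (ball c r) x * ennreal (V x) \<partial>lborel)
      \<le> (\<integral>\<^sup>+x. indicator (ball 0 r) x * ennreal ((r / norm x) powr (N / 2)) + indicator (ball c r) x \<partial>lborel)"
      by (intro nn_integral_mono) (auto simp: V_def split: split_indicator)
    also have "\<dots> = (\<integral>\<^sup>+x. indicator (ball 0 r) x * ennreal ((r / norm x) powr (N / 2)) \<partial>(lborel :: 'a measure))
        + emeasure lborel (ball c r)"
      by (subst nn_integral_add) auto
    also have "\<dots> \<le> ennreal (K' * r powr N) + ennreal (unit_ball_vol N * r powr N)"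
      using K'[rule_format, OF r(1)] r by (intro add_mono) (auto simp: N_def emeasure_ball powr_realpow)
    also have "\<dots> = ennreal ((K' + unit_ball_vol N) * r powr N)"
      using K'0 N0 by (simp add: distrib_right unit_ball_vol_nonneg flip: ennreal_plus)
    finally show ?thesis .
  qed
  have "(\<integral>\<^sup>+x. ennreal (indicator (ball c r) x * hardy q x) \<partial>lborel)
    \<le> (\<integral>\<^sup>+x. ennreal (M powr (q / p) / M) * (ennreal (hardy p x) * ennreal (W x))
        + ennreal (M powr (q / p)) * (indicator (ball c r) x * ennreal (V x)) \<partial>lborel)"
  proof (rule nn_integral_mono)
    fix x
    show "ennreal (indicator (ball c r) x * hardy q x)
      \<le> ennreal (M powr (q / p) / M) * (ennreal (hardy p x) * ennreal (W x))
        + ennreal (M powr (q / p)) * (indicator (ball c r) x * ennreal (V x))"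
    proof (cases "x \<in> ball c r")
      case True
      have nn: "hardy p x \<ge> 0" "W x \<ge> 0" "V x \<ge> 0"
        by (auto simp: hardy_nonneg W_def radial_weight_nonneg V_def)
      have "ennreal (hardy q x) \<le> ennreal (M powr (q / p) / M * (hardy p x * W x) + M powr (q / p) * V x)"
        using pt[OF True] by (intro ennreal_leI) (simp add: distrib_left)
      also have "\<dots> = ennreal (M powr (q / p) / M) * (ennreal (hardy p x) * ennreal (W x))
        + ennreal (M powr (q / p)) * ennreal (V x)"
        using nn M by (subst ennreal_plus) (simp_all only: ennreal_mult' ennreal_mult mult_nonneg_nonneg divide_nonneg_pos powr_ge_zero)
      finally show ?thesis using True by simp
    qed simp
  qed
  also have "\<dots> = ennreal (M powr (q / p) / M) * (\<integral>\<^sup>+x. ennreal (hardy p x) * ennreal (W x) \<partial>lborel)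
        + ennreal (M powr (q / p)) * (\<integral>\<^sup>+x. indicator (ball c r) x * ennreal (V x) \<partial>lborel)"
    by (simp add: nn_integral_add nn_integral_cmult)
  also have "\<dots> \<le> ennreal (M powr (q / p) / M) * ennreal (C * (K * L) * I)
        + ennreal (M powr (q / p)) * ennreal ((K' + unit_ball_vol N) * r powr N)"
    by (intro add_mono mult_left_mono Z V1) auto
  also have "\<dots> = ennreal (M powr (q / p) / M * (C * (K * L) * I) + M powr (q / p) * ((K' + unit_ball_vol N) * r powr N))"
  proof -
    have nn: "M powr (q / p) / M \<ge> 0" "M powr (q / p) \<ge> 0" "C * (K * L) * I \<ge> 0" "(K' + unit_ball_vol N) * r powr N \<ge> 0"
      using M C0 KL I0 K'0 N0 by (auto simp: unit_ball_vol_nonneg intro!: mult_nonneg_nonneg add_nonneg_nonneg)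
    show ?thesis
      unfolding ennreal_mult'[OF nn(1), symmetric] ennreal_mult'[OF nn(2), symmetric]
      by (rule ennreal_plus[symmetric]) (intro mult_nonneg_nonneg nn)+
  qed
  also have "\<dots> \<le> ennreal ((C * K + K' + unit_ball_vol N) * r powr N * M powr (q / p))"
  proof (rule ennreal_leI)
    \<comment> \<open>The condition on \<open>M\<close> absorbs the logarithm:
      \<open>L * I \<le> M * r powr N\<close>, so the part with \<open>W\<close> has the same size
      \<open>r powr N * M powr (q / p)\<close> as the part with \<open>V\<close>.\<close>
    have "L * I = L * I * r powr (- N) * r powr N" using r by (simp add: powr_minus)
    also have "\<dots> \<le> M * r powr N" using M(2) by (intro mult_right_mono) (auto simp: L_def N_def)
    finally have "M powr (q / p) / M * (C * K) * (L * I) \<le> M powr (q / p) / M * (C * K) * (M * r powr N)"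
      using M C0 K0 by (intro mult_left_mono) auto
    also have "\<dots> = C * K * r powr N * M powr (q / p)" using M by simp
    finally show "M powr (q / p) / M * (C * (K * L) * I) + M powr (q / p) * ((K' + unit_ball_vol N) * r powr N)
      \<le> (C * K + K' + unit_ball_vol N) * r powr N * M powr (q / p)"
      by (simp add: algebra_simps)
  qed
  finally have fin: "(\<integral>\<^sup>+x. ennreal (indicator (ball c r) x * hardy q x) \<partial>lborel)
    \<le> ennreal ((C * K + K' + unit_ball_vol N) * r powr N * M powr (q / p))" .
  have "(LINT x:ball c r|lborel. hardy q x) = enn2real (\<integral>\<^sup>+x. ennreal (indicator (ball c r) x * hardy q x) \<partial>lborel)"
    unfolding set_lebesgue_integral_def real_scaleR_def
    by (intro integral_eq_nn_integral) (auto simp: hardy_nonneg)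
  also have "\<dots> \<le> enn2real (ennreal ((C * K + K' + unit_ball_vol N) * r powr N * M powr (q / p)))"
    by (intro enn2real_mono fin) auto
  also have "\<dots> = (C * K + K' + unit_ball_vol N) * r powr N * M powr (q / p)"
    using C0 K0 K'0 N0 by (intro enn2real_ennreal mult_nonneg_nonneg) (auto simp: unit_ball_vol_nonneg)
  finally show "(LINT x:ball c r|lborel. hardy q x)
    \<le> (C * K + K' + unit_ball_vol (real DIM('a))) * r powr real DIM('a) * M powr (q / p)"
    by (simp only: N_def)
qed

end

subsection \<open>Test functions\<close>

lemma has_derivative_gradient:
  fixes u :: "'a::euclidean_space \<Rightarrow> real"
  assumes "u differentiable (at x)"
  shows "(u has_derivative (\<lambda>h. gradient u x \<bullet> h)) (at x)"
proof -
  have D: "(u has_derivative frechet_derivative u (at x)) (at x)"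
    using assms by (simp add: frechet_derivative_works)
  then have lin: "linear (frechet_derivative u (at x))"
    by (rule has_derivative_linear)
  have "frechet_derivative u (at x) h = gradient u x \<bullet> h" for h
  proof -
    have "frechet_derivative u (at x) h = frechet_derivative u (at x) (\<Sum>b\<in>Basis. (h \<bullet> b) *\<^sub>R b)"
      by (simp add: euclidean_representation)
    also have "\<dots> = (\<Sum>b\<in>Basis. (h \<bullet> b) * frechet_derivative u (at x) b)"
      by (simp add: linear_sum[OF lin] linear_scale[OF lin])
    also have "\<dots> = gradient u x \<bullet> h"
      by (simp add: gradient_def inner_sum_left inner_commute[of h] mult.commute)
    finally show ?thesis .
  qed
  then have "frechet_derivative u (at x) = (\<lambda>h. gradient u x \<bullet> h)" by auto
  with D show ?thesis by simp
qed

text \<open>Since the domain contains 0, all its points have norm at most its diameter; this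
  supplies the outer radius. The support is closed and avoids 0, which supplies the inner
  one.\<close>

lemma test_function_annular:
  fixes \<Omega> :: "'a::euclidean_space set"
  assumes \<Omega>: "bounded_domain \<Omega>" "0 \<in> \<Omega>" and u: "u \<in> test_functions (\<Omega> - {0})"
    and diam: "diameter \<Omega> > 0"
  shows "\<exists>e. annular_function u (gradient u) e (diameter \<Omega>)"
    and "x \<notin> \<Omega> \<Longrightarrow> u x = 0 \<and> gradient u x = 0"
proof -
  define S where "S = closure {x. u x \<noteq> 0}"
  have S: "compact S" "S \<subseteq> \<Omega> - {0}" and sm: "smooth_on (\<Omega> - {0}) u"
    using u by (auto simp: test_functions_def S_def)
  have cS: "closed S" by (simp add: S_def)
  have oS: "open (- S)" by (simp add: S_def open_Compl)
  have o\<Omega>: "open (\<Omega> - {0})" using \<Omega> by (simp add: bounded_domain_def open_delete)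
  have C1: "Ck_on (Suc 0) (\<Omega> - {0}) u" using sm by (simp add: smooth_on_def del: Ck_on.simps)
  have u0: "u x = 0" if "x \<notin> S" for x
    using that closure_subset[of "{x. u x \<noteq> 0}"] by (auto simp: S_def)
  have d0: "(u has_derivative (\<lambda>_. 0)) (at x)" if "x \<notin> S" for x
    by (rule has_derivative_transform_within_open[OF has_derivative_const[of 0] oS])
      (use that u0 in auto)
  have diff: "u differentiable (at x)" for x
    using C1 S d0[of x] by (cases "x \<in> S") (auto simp: differentiable_def)
  have g0: "gradient u x = 0" if "x \<notin> S" for x
    using frechet_derivative_at[OF d0[OF that], symmetric] by (simp add: gradient_def)
  have "continuous_on (\<Omega> - {0}) (gradient u)"
    unfolding gradient_def[abs_def] using C1 by (intro continuous_intros) auto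
  moreover have "continuous_on (- S) (gradient u)"
    by (subst continuous_on_cong[OF refl, of _ _ "\<lambda>_. 0"]) (auto simp: g0)
  \<comment> \<open>The gradient is continuous on two open sets, one by smoothness and one because
    it is 0 there, and these sets cover the space, the origin included.\<close>
  ultimately have "continuous_on ((\<Omega> - {0}) \<union> - S) (gradient u)"
    by (intro continuous_on_open_Un o\<Omega> oS)
  moreover have "(\<Omega> - {0}) \<union> - S = UNIV" using S by auto
  ultimately have cg: "continuous_on UNIV (gradient u)" by simp
  have "0 \<in> - S" using S by auto
  then obtain e where e: "e > 0" "ball 0 e \<subseteq> - S" using oS by (meson open_contains_ball)
  define e' where "e' = min e (diameter \<Omega>)"
  have out: "x \<notin> S" if "norm x < e' \<or> diameter \<Omega> < norm x" for x
    using that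
  proof
    assume "norm x < e'"
    then have "x \<in> ball 0 e" by (simp add: e'_def)
    then show ?thesis using e by auto
  next
    assume "diameter \<Omega> < norm x"
    moreover have "norm x \<le> diameter \<Omega>" if "x \<in> S"
    proof -
      have "x \<in> \<Omega>" using that S by auto
      then have "dist x 0 \<le> diameter \<Omega>"
        using \<Omega> by (intro diameter_bounded_bound) (auto simp: bounded_domain_def)
      then show ?thesis by simp
    qed
    ultimately show ?thesis by auto
  qed
  have "annular_function u (gradient u) e' (diameter \<Omega>)"
  proof
    show "(u has_derivative (\<lambda>h. gradient u x \<bullet> h)) (at x)" for x
      by (rule has_derivative_gradient[OF diff])
    show "u x = 0 \<and> gradient u x = 0" if "norm x < e' \<or> diameter \<Omega> < norm x" for x
      using out[OF that] u0 g0 by auto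
  qed (use e diam cg in \<open>auto simp: e'_def\<close>)
  then show "\<exists>e. annular_function u (gradient u) e (diameter \<Omega>)" ..
  show "u x = 0 \<and> gradient u x = 0" if "x \<notin> \<Omega>"
    using that S u0 g0 by auto
qed

text \<open>Covers a vanishing deficit: an estimate available for positive parameters only passes to
  \<open>m\<^sub>0 = 0\<close> by continuity of \<open>m powr a\<close> from the right.\<close>

lemma le_mult_powr_limit:
  fixes T K m\<^sub>0 a :: real
  assumes le: "\<And>m. m > 0 \<Longrightarrow> m\<^sub>0 \<le> m \<Longrightarrow> T \<le> K * m powr a" and "m\<^sub>0 \<ge> 0" "a > 0"
  shows "T \<le> K * m\<^sub>0 powr a"
proof (rule tendsto_lowerbound)
  show "((\<lambda>\<epsilon>. K * (m\<^sub>0 + \<epsilon>) powr a) \<longlongrightarrow> K * m\<^sub>0 powr a) (at_right 0)"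
    using assms(2,3)
    by (intro tendsto_mult tendsto_const tendsto_powr') 
      (auto intro!: tendsto_eq_intros simp: eventually_at_filter)
  show "eventually (\<lambda>\<epsilon>. T \<le> K * (m\<^sub>0 + \<epsilon>) powr a) (at_right 0)"
    unfolding eventually_at_right_field using assms by (intro exI[of _ 1]) auto
qed simp

section \<open>Constants, and the inequality on a bounded domain\<close>

theorem mainTheorem8:
  fixes p q :: real
  assumes "CARD('n::finite) \<ge> 2"
    and "p > real CARD('n)"
    and "1 \<le> q" and "q < p"
  shows "\<exists>\<Theta> C :: real. \<Theta> \<ge> 0 \<and> C > 0 \<and>
    (\<forall>(\<Omega> :: (real^'n) set) u c r D.
       bounded_domain \<Omega> \<longrightarrow> 0 \<in> \<Omega> \<longrightarrow> u \<in> test_functions (\<Omega> - {0}) \<longrightarrow>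
       0 < r \<longrightarrow> r < diameter \<Omega> \<longrightarrow> D \<ge> exp \<Theta> * diameter \<Omega> \<longrightarrow>
       r powr (real CARD('n) / p) * logX (r / D) powr (1 / p) *
         (1 / measure lborel (ball c r) *
            (LINT x:ball c r|lborel. \<bar>u x\<bar> powr q / norm x powr q)) powr (1 / q)
       \<le> C * ((LINT x:\<Omega>|lborel. norm (gradient u x) powr p)
               - ((p - real CARD('n)) / p) powr p
                 * (LINT x:\<Omega>|lborel. \<bar>u x\<bar> powr p / norm x powr p)) powr (1 / p))"
proof -
  define N where "N = real CARD('n)"
  have DIM: "DIM(real^'n) = CARD('n)" by simp
  have N: "N \<ge> 2" "N < p" using assms by (auto simp: N_def)
  have p2: "p \<ge> 2" using N by simp
  obtain C where C: "log_hardy_bound N p C"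
    using log_hardy_bound_exists[OF p2 N(2)] by blast
  have C0: "C > 0" using C by (simp add: log_hardy_bound_def)
  have "N * (p - q) / (2 * q) > 0" using N assms by simp
  from radial_weight_ray[where 'a = "real^'n", OF this]
  obtain K where K0: "K > 0" and K: "\<forall>r m d D. \<forall>y::real^'n. 0 < r \<longrightarrow> r \<le> m \<longrightarrow> 0 < d \<longrightarrow> d \<le> D \<longrightarrow> r \<le> D \<longrightarrow> y \<in> shell \<longrightarrow>
      (\<integral>\<^sup>+s. indicator {0<..} s * ennreal (max 0 (1 + ln (2 * d / s)) / s) *
         ennreal (radial_weight (N * (p - q) / (2 * q)) r m (s *\<^sub>R y)) \<partial>lborel)
      \<le> ennreal (K * (1 + ln (D / r)))"
    by (elim exE conjE)
  from nn_integral_ball_sqrt_singularity[where 'a = "real^'n", unfolded DIM, folded N_def]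
  obtain K' where K'0: "K' > 0" and K': "\<forall>r>0.
      (\<integral>\<^sup>+x. indicator (ball 0 r) x * ennreal ((r / norm x) powr (N / 2)) \<partial>(lborel :: (real^'n) measure))
        \<le> ennreal (K' * r powr N)"
    by (elim exE conjE)
  define v where "v = unit_ball_vol N"
  have v0: "v > 0" using N by (simp add: v_def unit_ball_vol_pos)
  \<comment> \<open>The three summands are the costs of the weighted Hardy term, of the singular
    weight in \<open>ball 0 r\<close>, and of the volume of \<open>ball c r\<close>. Dividing by
    \<open>v\<close> later normalizes the average.\<close>
  define A where "A = C * K + K' + v"
  have A0: "A > 0" using C0 K0 K'0 v0 by (auto simp: A_def intro!: add_pos_pos)
  have "r powr (N / p) * logX (r / D) powr (1 / p) *
         (1 / measure lborel (ball c r) *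
            (LINT x:ball c r|lborel. \<bar>u x\<bar> powr q / norm x powr q)) powr (1 / q)
       \<le> (A / v) powr (1 / q) * ((LINT x:\<Omega>|lborel. norm (gradient u x) powr p)
               - ((p - N) / p) powr p
                 * (LINT x:\<Omega>|lborel. \<bar>u x\<bar> powr p / norm x powr p)) powr (1 / p)"
    if \<Omega>: "bounded_domain \<Omega>" "0 \<in> \<Omega>" and u: "u \<in> test_functions (\<Omega> - {0})"
      and r: "0 < r" "r < diameter \<Omega>" and D: "D \<ge> exp 0 * diameter \<Omega>"
    for \<Omega> :: "(real^'n) set" and u c r D
  proof -
    have diam: "diameter \<Omega> > 0" using r by simp
    obtain e where "annular_function u (gradient u) e (diameter \<Omega>)"
      using test_function_annular(1)[OF \<Omega> u diam] by blast
    then interpret annular_function u "gradient u" e "diameter \<Omega>" .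
    note out = test_function_annular(2)[OF \<Omega> u diam]
    define I where "I = (LINT x|lborel. norm (gradient u x) powr p) - ((p - N) / p) powr p * (LINT x|lborel. hardy p x)"
    have "(LINT x:\<Omega>|lborel. norm (gradient u x) powr p) = (LINT x|lborel. norm (gradient u x) powr p)"
      unfolding set_lebesgue_integral_def by (intro Bochner_Integration.integral_cong) (auto simp: out indicator_def)
    moreover have "(LINT x:\<Omega>|lborel. \<bar>u x\<bar> powr p / norm x powr p) = (LINT x|lborel. hardy p x)"
      unfolding set_lebesgue_integral_def hardy_def
      by (intro Bochner_Integration.integral_cong) (auto simp: out indicator_def)
    ultimately have I: "(LINT x:\<Omega>|lborel. norm (gradient u x) powr p)
        - ((p - N) / p) powr p * (LINT x:\<Omega>|lborel. \<bar>u x\<bar> powr p / norm x powr p) = I"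
      by (simp add: I_def)
    define L where "L = 1 + ln (D / r)"
    \<comment> \<open>The witness is \<open>\<Theta> = 0\<close>:
      \<open>D \<ge> diameter \<Omega>\<close> already makes \<open>L \<ge> 1\<close> and allows
      \<open>d = diameter \<Omega>\<close> in the ray estimate.\<close>
    have D': "diameter \<Omega> \<le> D" "r \<le> D" "D > 0" using D r by auto
    have L: "L \<ge> 1" using r D' by (simp add: L_def)
    define T where "T = (LINT x:ball c r|lborel. hardy q x)"
    note ha = hardy_average[OF assms(3,4) p2, unfolded DIM, folded N_def, OF N(2) C K K0 K' K'0 r(1) D'(2,1),
        folded L_def I_def]
    have avg: "I \<ge> 0" "T \<le> A * r powr N * M powr (q / p)"
      if "M > 0" "L * I * r powr (- N) \<le> M" for M
    proof -
      show "I \<ge> 0" by (rule ha(1)[OF that])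
      show "T \<le> A * r powr N * M powr (q / p)"
        unfolding A_def v_def T_def by (rule ha(2)[OF that])
    qed
    \<comment> \<open>Any admissible \<open>M\<close> yields the sign of \<open>I\<close>; it must
      be known before the optimal \<open>M\<close> below can be used, since that one may be
      0.\<close>
    have I0: "I \<ge> 0" by (rule avg(1)[of "max 1 (L * I * r powr (- N))"]) auto
    define M where "M = L * I * r powr (- N)"
    have M0: "M \<ge> 0" using L I0 by (simp add: M_def)
    have T: "T \<le> A * r powr N * M powr (q / p)"
    proof (rule le_mult_powr_limit[OF _ M0])
      show "q / p > 0" using assms by simp
      show "T \<le> A * r powr N * m powr (q / p)" if "m > 0" "M \<le> m" for m
        using that unfolding M_def by (rule avg(2))
    qed
    have T0: "T \<ge> 0"
      unfolding T_def set_lebesgue_integral_def by (intro integral_nonneg_AE) (auto simp: hardy_nonneg)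
    have vol: "measure lborel (ball c r) = v * r powr N"
      using r by (simp add: content_ball v_def N_def powr_realpow)
    have "(1 / measure lborel (ball c r) * T) powr (1 / q) \<le> (A / v * M powr (q / p)) powr (1 / q)"
    proof (rule powr_mono2)
      have "1 / measure lborel (ball c r) * T \<le> 1 / (v * r powr N) * (A * r powr N * M powr (q / p))"
        unfolding vol using v0 r by (intro mult_left_mono T) auto
      also have "\<dots> = A / v * M powr (q / p)" using r by simp
      finally show "1 / measure lborel (ball c r) * T \<le> A / v * M powr (q / p)" .
    qed (use assms T0 in auto)
    also have "\<dots> = (A / v) powr (1 / q) * M powr (1 / p)"
      using assms by (simp only: powr_mult powr_powr) simp
    also have "M powr (1 / p) = L powr (1 / p) * I powr (1 / p) * r powr (- N / p)"
      by (simp add: M_def powr_mult powr_powr)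
    finally have B: "(1 / measure lborel (ball c r) * T) powr (1 / q)
        \<le> (A / v) powr (1 / q) * (L powr (1 / p) * I powr (1 / p) * r powr (- N / p))" .
    \<comment> \<open>\<open>logX\<close> is exactly the reciprocal of \<open>L\<close>, so the
      logarithmic loss and the factor \<open>r powr (- N / p)\<close> cancel against the prefactor
      of the claim.\<close>
    have X: "logX (r / D) = 1 / L"
      using r D' by (simp add: logX_def L_def ln_div inverse_eq_divide)
    have "r powr (N / p) * logX (r / D) powr (1 / p) * (1 / measure lborel (ball c r) * T) powr (1 / q)
      \<le> r powr (N / p) * logX (r / D) powr (1 / p) *
        ((A / v) powr (1 / q) * (L powr (1 / p) * I powr (1 / p) * r powr (- N / p)))"
      by (intro mult_left_mono B) auto
    also have "\<dots> = (A / v) powr (1 / q) * I powr (1 / p)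
        * (r powr (N / p) * r powr (- N / p)) * (logX (r / D) powr (1 / p) * L powr (1 / p))"
      by (simp only: mult_ac)
    also have "r powr (N / p) * r powr (- N / p) = 1" using r by (simp flip: powr_add)
    also have "logX (r / D) powr (1 / p) * L powr (1 / p) = 1"
      using L by (simp add: X flip: powr_mult)
    finally show ?thesis unfolding I by (simp add: T_def hardy_def)
  qed
  moreover have "(A / v) powr (1 / q) > 0" using A0 v0 by simp
  ultimately show ?thesis unfolding N_def by (intro exI[of _ 0] exI[of _ "(A / v) powr (1 / q)"]) blast
qed

end
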